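(* Let $\varepsilon>0$. Under Assumptions (1)–(5) listed in the context (where $f=l\circ c$), let $\{x^k,y^k,z^k\}$ be generated by the damped proximal augmented Lagrangian method (DPALM) described in the context with $$\beta_k=\beta_0\sqrt{k+1},\qquad v_k=\frac{v_0}{\sqrt{k+1}\,(\log(k+1))^2}\quad(k\ge1)$$ for some $\beta_0>0$, $v_0>0$ (which are also the values at $k=0$), such that for all $k\ge 0$ $$\operatorname{dist}\big(0,\partial_x\widetilde{\mathcal L}^{\nu_k}_{\beta_k}(x^{k+1};y^k,z^k)\big)\le\varepsilon_k:=\min\Big\{\frac{\varepsilon}{16C_4},\sqrt{\frac{\rho}{2\beta_k}},1\Big\},\qquad \nu_k=\nu:=\min\Big\{1,\frac{\varepsilon^2}{64C_4^2\rho M_l^2}\Big\}.$$ Then for some $k\le K:=\overline K_1+\overline K_2$, $x^k$ is a near $\varepsilon$-KKT point of problem (P), where $\overline K_1:=\lceil C_5\varepsilon^{-2}\rceil$, $\overline K_2:=\lceil64\rho C_xC_4^2\varepsilon^{-2}\rceil$, and the constants $C_4,C_5,C_x$ are defined in the context.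
   Context: Problem (P): $\min_{x\in\mathbb R^d}F(x):=f(x)+h(x)$ subject to $Ax=b$, $g(x):=[g_1(x),\dots,g_m(x)]\le 0$, where $A\in\mathbb R^{n\times d}$, $b\in\mathbb R^n$, and $F$ is continuous on its domain $\mathcal X:=\mathrm{dom}(F)$. $\|\cdot\|$ is the Euclidean (spectral, for matrices) norm; $[a]_+$ is the componentwise positive part; $\log$ is natural. Assumptions. (1) $\mathcal X$ is compact with diameter $D=\max_{x_1,x_2\in\mathcal X}\|x_1-x_2\|$; $f$ is $\rho$-weakly convex on $\mathcal X$ for some $\rho>0$ (i.e. $f+\frac\rho2\|\cdot\|^2$ is convex); $h$ is closed convex and admits an efficient proximal mapping. (2) Each $g_i:\mathbb R^d\to\mathbb R$ is convex and $L_g$-smooth (gradient $L_g$-Lipschitz) on an open set containing $\mathcal X$. (3) There is $x_{\rm feas}\in\mathrm{int}(\mathcal X)$ with $Ax_{\rm feas}=b$ and $g_{\min}:=\min_{i}-g_i(x_{\rm feas})>0$. (4) There is $r_h>0$ with $\emptyset\ne\partial h(x)\subseteq\mathcal N_{\mathcal X}(x)+\{u:\|u\|\le r_h\}$ for all $x\in\mathcal X$ ($\mathcal N_{\mathcal X}$ is the normal cone). (5) $f=l\circ c$, where $c:\mathbb R^d\to\mathbb R^p$ is a smooth mapping satisfying $\|J_c(x_1)-J_c(x_2)\|_F\le L_c\|x_1-x_2\|$ for all $x_1,x_2\in\mathbb R^d$ ($J_c$ Jacobian, $\|\cdot\|_F$ Frobenius norm) and $l:\mathbb R^p\to\mathbb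 R$ is convex, possibly non-smooth, and $M_l$-Lipschitz. $B_g>0$ is a constant with $\max\{|g_i(x)|,\|\nabla g_i(x)\|\}\le B_g$ and $|g_i(x)-g_i(\tilde x)|\le B_g\|x-\tilde x\|$ for all $x,\tilde x\in\mathcal X$, $i\in[m]$. Put $\|\nabla c\|:=\|J_c(x_{\rm feas})\|_F+L_cD$ and $\widetilde B_f:=M_l\|\nabla c\|$. For a $\rho$-weakly convex $\psi$, $\partial\psi(x):=\partial(\psi+\frac\rho2\|\cdot\|^2)(x)-\rho x$, the right-hand subdifferential being the usual convex one. Smoothing: for $\nu>0$, $l^\nu(u)=\min_w\{l(w)+\frac1{2\nu}\|w-u\|^2\}$ (Moreau envelope) and $f^\nu(x;\bar x):=l^\nu(c(\bar x)+J_c(\bar x)(x-\bar x))$. Define $$\widetilde{\mathcal L}^{\nu_k}_{\beta_k}(x;y^k,z^k)=f^{\nu_k}(x;x^k)+(y^k)^\top(Ax-b)+\tfrac{\beta_k}2\|Ax-b\|^2+\tfrac{\beta_k}2\big\|[g(x)+\tfrac{z^k}{\beta_k}]_+\big\|^2-\tfrac{\|z^k\|^2}{2\beta_k}+h(x)+\tfrac\rho2\|x-x^k\|^2.$$ DPALM: choose $x^0\in\mathcal X$, $y^0\in\mathrm{Range}(A)$, $z^0\ge0$. For $k=0,1,\dots$: compute $x^{k+1}$ as an approximate minimizer of $\widetilde{\mathcal L}^{\nu_k}_{\beta_k}(\cdot;y^k,z^k)$ meeting the stated tolerance; set $y^{k+1}=y^k+\alpha_k(Ax^{k+1}-b)$,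 $z^{k+1}=z^k+\alpha_k\max\{-z^k/\beta_k,\,g(x^{k+1})\}$ (componentwise max), with $\alpha_k=\min\big\{\beta_k,\ v_k/\sqrt{\|Ax^{k+1}-b\|^2+\|[g(x^{k+1})]_+\|^2}\big\}$ and the convention $v/0=+\infty$ for $v>0$. $\varepsilon$-KKT point: $x\in\mathcal X$ for which there exist $y\in\mathbb R^n$, $z\in\mathbb R^m_+$ with $\max\{\operatorname{dist}(0,\partial F(x)+J_g(x)^\top z+A^\top y),\ \sqrt{\|Ax-b\|^2+\|[g(x)]_+\|^2},\ \sum_{i=1}^m|z_ig_i(x)|\}\le\varepsilon$ ($J_g$ is the Jacobian of $g$). Near $\varepsilon$-KKT point: a point $\bar x$ with $\|\bar x-x\|\le\varepsilon$ for some $\varepsilon$-KKT point $x$. Constants ($\lambda_{\min}^+$ = smallest positive eigenvalue, $\mathrm{bd}$ = boundary, $\dagger$ = pseudoinverse): $\tau=\min\{\frac{g_{\min}}{2\sqrt mB_g},\operatorname{dist}(x_{\rm feas},\mathrm{bd}(\mathcal X))\}$; $\overline B=D(r_h+\widetilde B_f)+2\rho D^2+D+\tau(1+r_h+\widetilde B_f+2\rho D)$; $\theta=\overline B/\min\{\tau\sqrt{\lambda_{\min}^+(AA^\top)},\frac{g_{\min}}2\}$; $B_p=\max\{\|(y^0,z^0)\|,\theta\}$; $Q=D(\widetilde B_f+2\rho D+r_h)$; $C_1=\frac1D+\frac1{\operatorname{dist}(x_{\rm feas},\mathrm{bd}(\mathcal X))}+\frac{B_g}{g_{\min}}$; $\widehat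 C_p=2\Big(B_p+\sqrt{\frac{Q^2}{g_{\min}^2}+Q^2\|(AA^\top)^\dagger A\|^2C_1^2}\Big)+1$; $C_p=2\widehat C_p$; $C_x=2\max_{x\in\mathcal X}|F(x)|+\frac1{4\beta_0}(14C_p^2+8B_pC_p+7B_p^2)+(10C_p+4B_p)\frac{v_0}{\beta_0}+\frac{\beta_0}2\big(\|Ax^0-b\|^2+\|[g(x^0)+\frac{z^0}{\beta_0}]_+\|^2\big)+|\langle y^0,Ax^0-b\rangle|$; $C_5=\max\{4C_p^2\beta_0^{-2},\,4(B_p^2+\frac{5C_p^2}2)^2\beta_0^{-2}\}$; $C_4=\max\Big\{\frac32,\ \frac3{2\rho}\sqrt{\|A\|^2+mB_g^2},\ \frac{4B_g}\rho\sqrt{m\beta_0\sqrt{C_5}},\ \frac{64}{\rho^2}mB_g^2\beta_0\sqrt{\rho C_x},\ \frac{8B_g}\rho\sqrt{m\beta_0},\ \frac3{4\rho}\Big\}$.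
   Formalization: The formal theorem additionally assumes ρ ≥ M_l L_c; for an arbitrary weak-convexity modulus ρ the claim fails, e.g. f = M x₁² (M ≥ 1) on [-1,1]² with A = (0 1), b = 0, g = -1, ρ ≤ M, where the iterates oscillate between (1,0) and (-1,0). *)

theory Defs
  imports "HOL-Analysis.Analysis" "HOL-Library.Set_Algebras"
begin

definition effective_domain :: "('a \<Rightarrow> ereal) \<Rightarrow> 'a set" where
  "effective_domain \<phi> = {x. \<phi> x < \<infinity>}"

definition epi :: "('a \<Rightarrow> ereal) \<Rightarrow> ('a \<times> real) set" where
  "epi \<phi> = {(x, r). \<phi> x \<le> ereal r}"

definition closed_convex_fun :: "('a::euclidean_space \<Rightarrow> ereal) \<Rightarrow> bool" where
  "closed_convex_fun \<phi> \<longleftrightarrow> (\<forall>x. \<phi> x \<noteq> -\<infinity>) \<and> closed (epi \<phi>) \<and> convex (epi \<phi>)"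

text \<open>Empty at points where the function is not finite.\<close>

definition subdifferential :: "('a::real_inner \<Rightarrow> ereal) \<Rightarrow> 'a \<Rightarrow> 'a set" where
  "subdifferential \<phi> x =
     {v. \<bar>\<phi> x\<bar> \<noteq> \<infinity> \<and> (\<forall>u. \<phi> x + ereal (v \<bullet> (u - x)) \<le> \<phi> u)}"

definition weak_subdifferential :: "real \<Rightarrow> ('a::real_inner \<Rightarrow> ereal) \<Rightarrow> 'a \<Rightarrow> 'a set" where
  "weak_subdifferential \<rho> \<psi> x =
     (\<lambda>v. v - \<rho> *\<^sub>R x) ` subdifferential (\<lambda>u. \<psi> u + ereal (\<rho> / 2 * (norm u)\<^sup>2)) x"

definition weakly_convex_on :: "real \<Rightarrow> 'a::real_normed_vector set \<Rightarrow> ('a \<Rightarrow> real) \<Rightarrow> bool" where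
  "weakly_convex_on \<rho> S f \<longleftrightarrow> convex_on S (\<lambda>x. f x + \<rho> / 2 * (norm x)\<^sup>2)"

definition normal_cone :: "'a::real_inner set \<Rightarrow> 'a \<Rightarrow> 'a set" where
  "normal_cone S x = (if x \<in> S then {v. \<forall>u\<in>S. v \<bullet> (u - x) \<le> 0} else {})"

text \<open>The distance to the empty set is \<^term>\<open>\<infinity>\<close>, whereas \<^const>\<open>infdist\<close> would give \<^term>\<open>0\<close>.\<close>

definition edist :: "'a::metric_space \<Rightarrow> 'a set \<Rightarrow> ereal" where
  "edist x S = (INF v\<in>S. ereal (dist x v))"

definition moreau_envelope :: "real \<Rightarrow> ('a::real_normed_vector \<Rightarrow> real) \<Rightarrow> 'a \<Rightarrow> real" where
  "moreau_envelope \<nu> l u = (INF w. l w + 1 / (2 * \<nu>) * (norm (w - u))\<^sup>2)"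

definition grad :: "('a::real_inner \<Rightarrow> real) \<Rightarrow> 'a \<Rightarrow> 'a" where
  "grad \<phi> x = (THE D. GDERIV \<phi> x :> D)"

definition L_smooth_on :: "real \<Rightarrow> 'a::real_inner set \<Rightarrow> ('a \<Rightarrow> real) \<Rightarrow> bool" where
  "L_smooth_on L U \<phi> \<longleftrightarrow> (\<forall>x\<in>U. \<exists>D. GDERIV \<phi> x :> D) \<and> L-lipschitz_on U (grad \<phi>)"

definition pos_part :: "real ^ 'm \<Rightarrow> real ^ 'm" where
  "pos_part a = (\<chi> i. max 0 (a $ i))"

definition min_pos_eigenvalue :: "real ^ 'n ^ 'n \<Rightarrow> real" where
  "min_pos_eigenvalue M = Min {\<mu>. 0 < \<mu> \<and> (\<exists>w. w \<noteq> 0 \<and> M *v w = \<mu> *\<^sub>R w)}"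

text \<open>The four Penrose conditions, which determine the pseudoinverse uniquely.\<close>

definition pseudoinverse :: "real ^ 'n ^ 'k \<Rightarrow> real ^ 'k ^ 'n" where
  "pseudoinverse M = (THE P. M ** P ** M = M \<and> P ** M ** P = P \<and>
     transpose (M ** P) = M ** P \<and> transpose (P ** M) = P ** M)"

text \<open>The spectral norm; the library norm of a matrix is the Frobenius norm.\<close>

definition spectral_norm :: "real ^ 'n ^ 'k \<Rightarrow> real" where
  "spectral_norm M = onorm (\<lambda>x. M *v x)"

definition feas_violation ::
  "real ^ 'd ^ 'n \<Rightarrow> real ^ 'n \<Rightarrow> (real ^ 'd \<Rightarrow> real ^ 'm) \<Rightarrow> real ^ 'd \<Rightarrow> real" where
  "feas_violation A b g x = sqrt ((norm (A *v x - b))\<^sup>2 + (norm (pos_part (g x)))\<^sup>2)"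

definition eps_KKT ::
  "real \<Rightarrow> (real ^ 'd \<Rightarrow> ereal) \<Rightarrow> real ^ 'd ^ 'n \<Rightarrow> real ^ 'n \<Rightarrow> (real ^ 'd \<Rightarrow> real ^ 'm)
    \<Rightarrow> real \<Rightarrow> real ^ 'd \<Rightarrow> bool" where
  "eps_KKT \<rho> F A b g \<epsilon> x \<longleftrightarrow> x \<in> effective_domain F \<and>
     (\<exists>y z. (\<forall>i. 0 \<le> z $ i) \<and>
        max (edist 0 ((\<lambda>v. v + transpose (jacobian g (at x)) *v z + transpose A *v y)
                        ` weak_subdifferential \<rho> F x))
          (max (ereal (feas_violation A b g x)) (ereal (\<Sum>i\<in>UNIV. \<bar>z $ i * g x $ i\<bar>)))
        \<le> ereal \<epsilon>)"

definition near_eps_KKT ::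
  "real \<Rightarrow> (real ^ 'd \<Rightarrow> ereal) \<Rightarrow> real ^ 'd ^ 'n \<Rightarrow> real ^ 'n \<Rightarrow> (real ^ 'd \<Rightarrow> real ^ 'm)
    \<Rightarrow> real \<Rightarrow> real ^ 'd \<Rightarrow> bool" where
  "near_eps_KKT \<rho> F A b g \<epsilon> x' \<longleftrightarrow> (\<exists>x. eps_KKT \<rho> F A b g \<epsilon> x \<and> norm (x' - x) \<le> \<epsilon>)"

definition smoothed_model ::
  "real \<Rightarrow> (real ^ 'p \<Rightarrow> real) \<Rightarrow> (real ^ 'd \<Rightarrow> real ^ 'p) \<Rightarrow> real ^ 'd \<Rightarrow> real ^ 'd \<Rightarrow> real" where
  "smoothed_model \<nu> l c x' x = moreau_envelope \<nu> l (c x' + jacobian c (at x') *v (x - x'))"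

definition prox_AL ::
  "real \<Rightarrow> real \<Rightarrow> real \<Rightarrow> (real ^ 'p \<Rightarrow> real) \<Rightarrow> (real ^ 'd \<Rightarrow> real ^ 'p) \<Rightarrow> (real ^ 'd \<Rightarrow> ereal)
    \<Rightarrow> real ^ 'd ^ 'n \<Rightarrow> real ^ 'n \<Rightarrow> (real ^ 'd \<Rightarrow> real ^ 'm)
    \<Rightarrow> real ^ 'd \<Rightarrow> real ^ 'n \<Rightarrow> real ^ 'm \<Rightarrow> real ^ 'd \<Rightarrow> ereal" where
  "prox_AL \<rho> \<nu> \<beta> l c h A b g xk yk zk x =
     ereal (smoothed_model \<nu> l c xk x + yk \<bullet> (A *v x - b) + \<beta> / 2 * (norm (A *v x - b))\<^sup>2
       + \<beta> / 2 * (norm (pos_part (g x + (1 / \<beta>) *\<^sub>R zk)))\<^sup>2 - (norm zk)\<^sup>2 / (2 * \<beta>)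
       + \<rho> / 2 * (norm (x - xk))\<^sup>2) + h x"

text \<open>The damped step size; \<open>r\<close> is the feasibility violation, and \<open>v / 0\<close> is read as \<open>+\<infinity>\<close>.\<close>

definition damped_step :: "real \<Rightarrow> real \<Rightarrow> real \<Rightarrow> real" where
  "damped_step \<beta> v r = (if r = 0 then \<beta> else min \<beta> (v / r))"

end

theory Submission
  imports Defs
begin

text \<open>
  Write \<open>p = (y, z)\<close> for the multipliers and
  \<open>p' = (y + \<beta> (A x - b), [z + \<beta> g(x)]\<^sub>+)\<close> for those appearing in the stationarity condition at the new
  iterate \<open>x\<close>. Testing that condition against the direction to the Slater point gives
  \<open>\<langle>p', p' - p\<rangle> / \<beta> + \<kappa> \<parallel>p'\<parallel> \<le> B_bar\<close>, so the ball of radius \<open>B_p\<close> is invariant under \<open>p \<mapsto> p'\<close>; the actual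
  multiplier update is a convex combination of \<open>p\<close> and \<open>p'\<close>. Hence \<open>B_p\<close> bounds all multipliers, and no
  duality theorem is needed. The infeasibility is at most \<open>\<parallel>p' - p\<parallel> / \<beta>\<close>, small once \<open>\<beta>\<close> is large.

  The augmented Lagrangian decreases by about \<open>\<rho>/4\<close> times the squared step in \<open>x\<close>, and its increase
  through the updates of the multipliers and of \<open>\<beta>\<close> is summable because the damping turns it into
  \<open>\<Sum> v_k / \<beta>_k\<close>, a series of the form \<open>\<Sum> 1 / (k (ln k)\<^sup>2)\<close>. So some step is short. For such a step the KKT point
  is the minimiser \<open>w\<close> of \<open>F + \<langle>y', A \<cdot> - b\<rangle> + \<langle>z', g\<rangle> + \<rho> \<parallel>\<cdot> - x_k\<parallel>\<^sup>2\<close>, whose stationarity residual is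
  \<open>2 \<rho> (x_k - w)\<close>; comparing this function with the smoothed model shows that \<open>w\<close> is close to \<open>x\<close>.
\<close>

section \<open>Subgradients and the Moreau envelope\<close>

text \<open>The balance rests on \<open>M_l * L_c \<le> \<rho>\<close>: replacing c by its
  linearization at x' changes l o c by at most (\<rho>/2) |u - x'|^2, so the proximal terms pay for
  the linearization and a positive multiple of \<rho> is left over. Descent can thus be stated for
  the true F, at the price \<nu> M_l^2 / 2 for the smoothing.

  The obstacle in the drift is that the damping sees only the positive part of g, while z also moves
  along inactive constraints. That movement decreases |z|^2, so the telescoping potential |z|^2 /
  \<beta> pays for it; a second potential, a multiple of B_p^2 / \<beta>, pays for the growth of
  \<beta>.

  With e = \<epsilon> / C_4 a step counts as short if (\<rho> |step|)^2 \<le> (7/64) e^2. The number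
  7 serves two ends. A long step gains 7 e^2 / (256 \<rho>), the inexactness and smoothing errors
  cost 3 of these 7 units, and the net gain e^2 / (64 \<rho>) against the budget C_x gives the
  second iteration count. A short step makes the quadratic inequality for |x - w| factor with the
  root 3/8.\<close>

lemma subgradient_sum_rule:
  fixes \<phi> S :: "'a::real_inner \<Rightarrow> real"
  assumes conv: "convex_on X \<phi>" and x: "x \<in> X" and u: "u \<in> X"
    and deriv: "GDERIV S x :> G"
    and sub: "\<And>u. u \<in> X \<Longrightarrow> \<phi> x + S x + \<xi> \<bullet> (u - x) \<le> \<phi> u + S u"
  shows "\<phi> x + (\<xi> - G) \<bullet> (u - x) \<le> \<phi> u"
proof -
  define d where "d = u - x"
  define \<gamma> where "\<gamma> t = S (x + t *\<^sub>R d)" for t :: real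
  have "(S has_derivative (\<lambda>h. h \<bullet> G)) (at (x + 0 *\<^sub>R d))"
    using deriv by (simp add: gderiv_def)
  then have "((\<lambda>t. S (x + t *\<^sub>R d)) has_derivative (\<lambda>t. (t *\<^sub>R d) \<bullet> G)) (at 0)"
    by (rule has_derivative_compose[rotated]) (auto intro!: derivative_eq_intros)
  then have "(\<gamma> has_field_derivative d \<bullet> G) (at 0)"
    unfolding \<gamma>_def has_field_derivative_def by (simp add: mult_commute_abs)
  then have "((\<lambda>t. (\<gamma> t - \<gamma> 0) / t) \<longlongrightarrow> d \<bullet> G) (at 0)"
    by (simp add: DERIV_def)
  then have lim: "((\<lambda>t. (\<gamma> t - \<gamma> 0) / t) \<longlongrightarrow> d \<bullet> G) (at_right 0)"
    by (rule filterlim_mono) (auto simp: at_within_le_at)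
  \<comment> \<open>Convexity keeps \<phi> below its chord on the segment from x to u, so the
    hypothesis at \<open>x + t *\<^sub>R d\<close> bounds the difference quotient of S from below. S
    enters only through this quotient and may even be concave.\<close>
  have ge: "\<xi> \<bullet> d - (\<phi> u - \<phi> x) \<le> (\<gamma> t - \<gamma> 0) / t" if t: "0 < t" "t < 1" for t
  proof -
    have eq: "x + t *\<^sub>R d = (1 - t) *\<^sub>R x + t *\<^sub>R u"
      by (simp add: d_def algebra_simps)
    have "\<phi> (x + t *\<^sub>R d) \<le> (1 - t) * \<phi> x + t * \<phi> u"
      unfolding eq using convex_onD[OF conv, of t x u] t x u by simp
    moreover have "x + t *\<^sub>R d \<in> X"
      unfolding eq using convex_on_imp_convex[OF conv] t x u by (simp add: convex_alt)
    then have "\<phi> x + \<gamma> 0 + t * (\<xi> \<bullet> d) \<le> \<phi> (x + t *\<^sub>R d) + \<gamma> t"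
      using sub[of "x + t *\<^sub>R d"] by (simp add: \<gamma>_def)
    ultimately have "t * (\<xi> \<bullet> d - (\<phi> u - \<phi> x)) \<le> \<gamma> t - \<gamma> 0"
      by (simp add: algebra_simps)
    then show ?thesis using t by (simp add: field_simps)
  qed
  have "\<xi> \<bullet> d - (\<phi> u - \<phi> x) \<le> d \<bullet> G"
  proof (rule tendsto_lowerbound[OF lim])
    show "\<forall>\<^sub>F t in at_right 0. \<xi> \<bullet> d - (\<phi> u - \<phi> x) \<le> (\<gamma> t - \<gamma> 0) / t"
      unfolding eventually_at_right_field using ge by (intro exI[of _ 1]) auto
  qed simp
  then show ?thesis by (simp add: d_def inner_diff_left inner_commute)
qed

text \<open>The sum rule for S = - \<phi>: the sum vanishes identically, so 0 is a subgradient of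
  it.\<close>

lemma convex_gradient_ineq:
  assumes "convex_on U \<phi>" "x \<in> U" "u \<in> U" "GDERIV \<phi> x :> G"
  shows "\<phi> x + G \<bullet> (u - x) \<le> \<phi> u"
  using subgradient_sum_rule[of U \<phi> x u "\<lambda>u. - \<phi> u" "- G" 0] assms GDERIV_minus by auto

lemma norm_add_square: "(norm (a + b))\<^sup>2 = (norm a)\<^sup>2 + 2 * (a \<bullet> b) + (norm b)\<^sup>2"
  for a b :: "'a::real_inner"
  unfolding power2_norm_eq_inner by (simp add: inner_add_left inner_add_right inner_commute)

lemma gderiv_square_dist: "GDERIV (\<lambda>w. a * (norm (w - u))\<^sup>2) x :> (2 * a) *\<^sub>R (x - u)"
  unfolding gderiv_def power2_norm_eq_inner
  by (auto intro!: derivative_eq_intros simp: fun_eq_iff algebra_simps inner_commute)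

lemma lipschitz_real_le:
  assumes "M-lipschitz_on UNIV (l :: _ \<Rightarrow> real)"
  shows "l u \<le> l w + M * norm (w - u)"
  using lipschitz_onD[OF assms, of u w] by (simp add: dist_norm norm_minus_commute abs_le_iff)

lemma quadratic_lower: "0 < \<nu> \<Longrightarrow> - (\<nu> * M\<^sup>2 / 2) \<le> 1 / (2 * \<nu>) * s\<^sup>2 - M * (s::real)"
proof -
  assume "0 < \<nu>"
  then have "1 / (2 * \<nu>) * s\<^sup>2 - M * s + \<nu> * M\<^sup>2 / 2 = (s - \<nu> * M)\<^sup>2 / (2 * \<nu>)"
    by (simp add: field_simps power2_eq_square)
  also have "\<dots> \<ge> 0" using \<open>0 < \<nu>\<close> by simp
  finally show ?thesis by simp
qed

text \<open>At distance s from u the function l has dropped by at most M s, and M s - s^2 / (2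
  \<nu>) is largest at s = \<nu> M. This is the whole smoothing error.\<close>

lemma moreau_objective_ge:
  assumes "M-lipschitz_on UNIV l" "0 < \<nu>"
  shows "l u - \<nu> * M\<^sup>2 / 2 \<le> l w + 1 / (2 * \<nu>) * (norm (w - u))\<^sup>2"
  using lipschitz_real_le[OF assms(1), of u w] quadratic_lower[OF assms(2), of M "norm (w - u)"]
  by linarith

lemma moreau_bdd_below:
  assumes "M-lipschitz_on UNIV l" "0 < \<nu>"
  shows "bdd_below (range (\<lambda>w. l w + 1 / (2 * \<nu>) * (norm (w - u))\<^sup>2))"
  using moreau_objective_ge[OF assms] by (intro bdd_belowI) blast

lemma moreau_envelope_le_objective:
  assumes "M-lipschitz_on UNIV l" "0 < \<nu>"
  shows "moreau_envelope \<nu> l u \<le> l w + 1 / (2 * \<nu>) * (norm (w - u))\<^sup>2"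
  unfolding moreau_envelope_def by (rule cINF_lower[OF moreau_bdd_below[OF assms]]) simp

lemma moreau_envelope_le:
  assumes "M-lipschitz_on UNIV l" "0 < \<nu>"
  shows "moreau_envelope \<nu> l u \<le> l u"
  using moreau_envelope_le_objective[OF assms, of u u] by simp

lemma moreau_envelope_ge:
  assumes "M-lipschitz_on UNIV l" "0 < \<nu>"
  shows "l u - \<nu> * M\<^sup>2 / 2 \<le> moreau_envelope \<nu> l u"
  unfolding moreau_envelope_def using moreau_objective_ge[OF assms] by (intro cINF_greatest) auto

text \<open>Beyond distance 2 \<nu> M from u the quadratic exceeds the largest possible drop of l,
  so a minimizer over that closed ball is a global one.\<close>

lemma moreau_envelope_attained:
  fixes l :: "'a::euclidean_space \<Rightarrow> real"
  assumes lip: "M-lipschitz_on UNIV l" and \<nu>: "0 < \<nu>"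
  obtains w where "moreau_envelope \<nu> l u = l w + 1 / (2 * \<nu>) * (norm (w - u))\<^sup>2"
proof -
  define \<Phi> where "\<Phi> w = l w + 1 / (2 * \<nu>) * (norm (w - u))\<^sup>2" for w
  have M: "0 \<le> M" using lip by (simp add: lipschitz_on_def)
  have cont: "continuous_on (cball u (2 * \<nu> * M)) \<Phi>"
    unfolding \<Phi>_def
    by (intro continuous_intros continuous_on_subset[OF lipschitz_on_continuous_on[OF lip]]) simp
  have "0 \<le> 2 * \<nu> * M" using M \<nu> by simp
  then have "cball u (2 * \<nu> * M) \<noteq> {}" by (metis cball_eq_empty not_less)
  then obtain w where w: "w \<in> cball u (2 * \<nu> * M)" "\<And>w'. w' \<in> cball u (2 * \<nu> * M) \<Longrightarrow> \<Phi> w \<le> \<Phi> w'"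
    using continuous_attains_inf[OF compact_cball _ cont] by metis
  have "\<Phi> w \<le> \<Phi> w'" for w'
  proof (cases "w' \<in> cball u (2 * \<nu> * M)")
    case False
    define s where "s = norm (w' - u)"
    have s: "2 * \<nu> * M < s" "0 \<le> s" using False by (auto simp: s_def dist_norm norm_minus_commute)
    have "\<Phi> w \<le> \<Phi> u" using w(2)[of u] M \<nu> by simp
    also have "\<dots> \<le> l w' + M * s" using lipschitz_real_le[OF lip, of u w'] by (simp add: \<Phi>_def s_def)
    also have "M * s \<le> 1 / (2 * \<nu>) * s\<^sup>2"
      using mult_right_mono[OF less_imp_le[OF s(1)] s(2)] \<nu> by (simp add: field_simps power2_eq_square)
    finally show ?thesis by (simp add: \<Phi>_def s_def)
  qed (use w in auto)
  then have "moreau_envelope \<nu> l u = \<Phi> w"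
    unfolding moreau_envelope_def \<Phi>_def[symmetric]
    by (intro antisym cINF_lower cINF_greatest bdd_belowI[of _ "\<Phi> w"]) auto
  then show ?thesis using that by (simp add: \<Phi>_def)
qed

text \<open>q is (u - w) / \<nu> for the proximal point w, and it is a subgradient of l at w.
  Completing the square turns this into the lower bound; inserting w as a competitor at u' gives the
  upper one. The quadratic upper bound is the form in which smoothness is used later, as a
  differentiable majorant.\<close>

lemma moreau_envelope_gradient:
  fixes l :: "'a::euclidean_space \<Rightarrow> real"
  assumes conv: "convex_on UNIV l" and lip: "M-lipschitz_on UNIV l" and \<nu>: "0 < \<nu>"
  obtains q where "norm q \<le> M"
    "\<And>u'. moreau_envelope \<nu> l u + q \<bullet> (u' - u) \<le> moreau_envelope \<nu> l u'"
    "\<And>u'. moreau_envelope \<nu> l u'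
       \<le> moreau_envelope \<nu> l u + q \<bullet> (u' - u) + 1 / (2 * \<nu>) * (norm (u' - u))\<^sup>2"
proof -
  obtain w where w: "moreau_envelope \<nu> l u = l w + 1 / (2 * \<nu>) * (norm (w - u))\<^sup>2"
    by (rule moreau_envelope_attained[OF lip \<nu>])
  define q where "q = (1 / \<nu>) *\<^sub>R (u - w)"
  have wq: "w = u - \<nu> *\<^sub>R q" using \<nu> by (simp add: q_def)
  have sub: "l w + q \<bullet> (w' - w) \<le> l w'" for w'
  proof -
    have "GDERIV (\<lambda>w. 1 / (2 * \<nu>) * (norm (w - u))\<^sup>2) w :> - q"
      using gderiv_square_dist[of "1 / (2 * \<nu>)" u w] \<nu>
      by (simp add: q_def algebra_simps)
    then show ?thesis
      using subgradient_sum_rule[OF conv, of w w' "\<lambda>w. 1 / (2 * \<nu>) * (norm (w - u))\<^sup>2" "- q" 0]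
        moreau_envelope_le_objective[OF lip \<nu>, of u] w by simp
  qed
  have env: "moreau_envelope \<nu> l u = l w + \<nu> / 2 * (norm q)\<^sup>2"
    using \<nu> by (simp add: w wq power_mult_distrib power2_eq_square)
  show thesis
  proof
    have "q \<bullet> q \<le> M * norm q"
      using sub[of "w + q"] lipschitz_real_le[OF lip, of "w + q" w] by simp
    then show "norm q \<le> M"
      by (cases "q = 0") (use lip in \<open>auto simp: lipschitz_on_def dot_square_norm power2_eq_square\<close>)
  next
    fix u'
    have "moreau_envelope \<nu> l u + q \<bullet> (u' - u) \<le> l w' + 1 / (2 * \<nu>) * (norm (w' - u'))\<^sup>2" for w'
    proof -
      have "0 \<le> 1 / (2 * \<nu>) * (norm (w' - u' + \<nu> *\<^sub>R q))\<^sup>2" using \<nu> by simp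
      also have "\<dots> = 1 / (2 * \<nu>) * (norm (w' - u'))\<^sup>2 + q \<bullet> (w' - u') + \<nu> / 2 * (norm q)\<^sup>2"
        using \<nu> unfolding norm_add_square
        by (simp add: inner_commute field_simps power2_eq_square)
      finally have "0 \<le> 1 / (2 * \<nu>) * (norm (w' - u'))\<^sup>2 + q \<bullet> (w' - u') + \<nu> / 2 * (norm q)\<^sup>2" .
      moreover have "q \<bullet> (w' - w) = q \<bullet> (w' - u') + q \<bullet> (u' - u) + \<nu> * (norm q)\<^sup>2"
        unfolding wq power2_norm_eq_inner by (simp add: inner_diff_right)
      ultimately show ?thesis using sub[of w'] env by (simp add: algebra_simps)
    qed
    then show "moreau_envelope \<nu> l u + q \<bullet> (u' - u) \<le> moreau_envelope \<nu> l u'"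
      unfolding moreau_envelope_def[of _ _ u'] by (intro cINF_greatest) auto
  next
    fix u'
    have "moreau_envelope \<nu> l u' \<le> l w + 1 / (2 * \<nu>) * (norm (w - u'))\<^sup>2"
      by (rule moreau_envelope_le_objective[OF lip \<nu>])
    also have "(norm (w - u'))\<^sup>2 = (norm (u' - u + \<nu> *\<^sub>R q))\<^sup>2"
      unfolding wq by (metis add_uminus_conv_diff minus_diff_eq norm_minus_cancel diff_diff_eq2 diff_add_eq)
    also have "1 / (2 * \<nu>) * \<dots> = 1 / (2 * \<nu>) * (norm (u' - u))\<^sup>2 + q \<bullet> (u' - u) + \<nu> / 2 * (norm q)\<^sup>2"
      using \<nu> unfolding norm_add_square
      by (simp add: inner_commute field_simps power2_eq_square)
    finally show "moreau_envelope \<nu> l u'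
       \<le> moreau_envelope \<nu> l u + q \<bullet> (u' - u) + 1 / (2 * \<nu>) * (norm (u' - u))\<^sup>2"
      using env by simp
  qed
qed

section \<open>Matrices and Jacobians\<close>

lemma inner_transpose_matrix_vector:
  "(transpose A *v y) \<bullet> u = y \<bullet> (A *v u)" for A :: "real ^ 'd ^ 'n"
  by (simp add: dot_lmul_matrix)

lemma norm_matrix_vector_mult_le:
  fixes M :: "real ^ 'd ^ 'n"
  shows "norm (M *v u) \<le> norm M * norm u"
proof -
  have "norm (M *v u) \<le> L2_set (\<lambda>i. norm (M $ i) * norm u) UNIV"
    unfolding norm_vec_def[of "M *v u"]
    by (rule L2_set_mono) (simp_all add: matrix_vector_mul_component Cauchy_Schwarz_ineq2)
  also have "\<dots> = norm M * norm u"
    unfolding norm_vec_def[of M] by (rule L2_set_left_distrib[symmetric]) simp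
  finally show ?thesis .
qed

lemma norm_matrix_vector_mult_le_spectral:
  "norm (A *v u) \<le> spectral_norm A * norm u" for A :: "real ^ 'd ^ 'n"
  unfolding spectral_norm_def by (rule onorm) simp

text \<open>Eigenvectors of distinct eigenvalues are orthogonal, hence independent. Finiteness is
  what gives the \<open>Min\<close> in \<open>min_pos_eigenvalue\<close> its meaning.\<close>

lemma finite_eigenvalues_symmetric:
  fixes S :: "real ^ 'n ^ 'n"
  assumes sym: "transpose S = S"
  shows "finite {\<mu>. \<exists>w. w \<noteq> 0 \<and> S *v w = \<mu> *\<^sub>R w}" (is "finite ?E")
proof -
  define w where "w \<mu> = (SOME w. w \<noteq> 0 \<and> S *v w = \<mu> *\<^sub>R w)" for \<mu>
  have w: "w \<mu> \<noteq> 0 \<and> S *v w \<mu> = \<mu> *\<^sub>R w \<mu>" if "\<mu> \<in> ?E" for \<mu>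
    unfolding w_def by (rule someI_ex) (use that in auto)
  have orth: "w \<mu> \<bullet> w \<mu>' = 0" if "\<mu> \<in> ?E" "\<mu>' \<in> ?E" "\<mu> \<noteq> \<mu>'" for \<mu> \<mu>'
  proof -
    have "\<mu> * (w \<mu> \<bullet> w \<mu>') = (S *v w \<mu>) \<bullet> w \<mu>'" using w that by simp
    also have "\<dots> = w \<mu> \<bullet> (S *v w \<mu>')" using inner_transpose_matrix_vector[of S] sym by metis
    also have "\<dots> = \<mu>' * (w \<mu> \<bullet> w \<mu>')" using w that by simp
    finally show ?thesis using that by simp
  qed
  have inj: "inj_on w ?E"
  proof (rule inj_onI, rule ccontr)
    fix \<mu> \<mu>' assume *: "\<mu> \<in> ?E" "\<mu>' \<in> ?E" "w \<mu> = w \<mu>'" "\<mu> \<noteq> \<mu>'"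
    then show False using orth[of \<mu> \<mu>'] w[of \<mu>'] by simp
  qed
  have "pairwise orthogonal (w ` ?E)"
    unfolding pairwise_def orthogonal_def using orth by auto
  moreover have "0 \<notin> w ` ?E" using w by force
  ultimately have "independent (w ` ?E)"
    by (rule pairwise_orthogonal_independent)
  then have "finite (w ` ?E)" by (rule independent_imp_finite)
  then show ?thesis using finite_imageD inj by blast
qed

text \<open>A minimizer w of the quadratic form on the unit sphere of V is an eigenvector: its
  residual r lies in V by invariance, and if r were nonzero, moving from w against r would undercut
  the minimum.\<close>

lemma rayleigh_minimum_eigenvector:
  fixes S :: "real ^ 'n ^ 'n"
  assumes sym: "transpose S = S" and V: "subspace V" "\<And>u. u \<in> V \<Longrightarrow> S *v u \<in> V" "V \<noteq> {0}"
  obtains w \<mu> where "w \<in> V" "norm w = 1" "S *v w = \<mu> *\<^sub>R w"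
    "\<And>u. u \<in> V \<Longrightarrow> \<mu> * (norm u)\<^sup>2 \<le> u \<bullet> (S *v u)"
proof -
  obtain v0 where v0: "v0 \<in> V" "v0 \<noteq> 0" using V(1,3) subspace_0 by blast
  have comp: "compact (V \<inter> sphere 0 1)"
    by (rule closed_Int_compact) (auto simp: closed_subspace V)
  have "v0 /\<^sub>R norm v0 \<in> V \<inter> sphere 0 1"
    using v0 V(1) by (auto simp: subspace_scale)
  then have ne: "V \<inter> sphere 0 1 \<noteq> {}" by blast
  have cont: "continuous_on (V \<inter> sphere 0 1) (\<lambda>u. u \<bullet> (S *v u))"
    by (intro continuous_intros matrix_vector_mult_linear_continuous_on)
  obtain w where w: "w \<in> V \<inter> sphere 0 1"
    "\<And>u. u \<in> V \<inter> sphere 0 1 \<Longrightarrow> w \<bullet> (S *v w) \<le> u \<bullet> (S *v u)"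
    using continuous_attains_inf[OF comp ne cont] by blast
  define \<mu> where "\<mu> = w \<bullet> (S *v w)"
  have wV: "w \<in> V" and w1: "norm w = 1" "w \<bullet> w = 1"
    using w by (auto simp: dot_square_norm)
  have ge: "\<mu> * (norm u)\<^sup>2 \<le> u \<bullet> (S *v u)" if "u \<in> V" for u
  proof (cases "u = 0")
    case False
    have "u /\<^sub>R norm u \<in> V \<inter> sphere 0 1"
      using False that V(1) by (auto simp: subspace_scale)
    then have "\<mu> \<le> (u /\<^sub>R norm u) \<bullet> (S *v (u /\<^sub>R norm u))"
      using w(2) \<mu>_def by blast
    also have "\<dots> = u \<bullet> (S *v u) / (norm u)\<^sup>2"
      by (simp add: matrix_vector_mult_scaleR power2_eq_square divide_inverse)
    finally show ?thesis using False by (simp add: field_simps)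
  qed simp
  define r where "r = S *v w - \<mu> *\<^sub>R w"
  have r: "r \<in> V" unfolding r_def by (intro subspace_diff subspace_scale V wV)
  have "r = 0"
  proof (rule ccontr)
    assume "r \<noteq> 0"
    define a where "a = r \<bullet> (S *v r) - \<mu> * (norm r)\<^sup>2"
    have a: "0 \<le> a" using ge[OF r] by (simp add: a_def)
    have exp: "0 \<le> 2 * t * (r \<bullet> r) + t\<^sup>2 * a" for t
    proof -
      have sw: "w \<bullet> (S *v r) = r \<bullet> (S *v w)"
        using inner_transpose_matrix_vector[of S w r] sym by (simp add: inner_commute)
      have "\<mu> * (norm (w + t *\<^sub>R r))\<^sup>2 \<le> (w + t *\<^sub>R r) \<bullet> (S *v (w + t *\<^sub>R r))"
        by (intro ge subspace_add subspace_scale V wV r)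
      also have "\<dots> = \<mu> + 2 * t * (r \<bullet> (S *v w)) + t\<^sup>2 * (r \<bullet> (S *v r))"
        by (simp add: matrix_vector_right_distrib matrix_vector_mult_scaleR inner_add_left inner_add_right
            sw \<mu>_def power2_eq_square algebra_simps)
      finally have "\<mu> * (norm (w + t *\<^sub>R r))\<^sup>2 \<le> \<mu> + 2 * t * (r \<bullet> (S *v w)) + t\<^sup>2 * (r \<bullet> (S *v r))" .
      moreover have "\<mu> * (norm (w + t *\<^sub>R r))\<^sup>2 = \<mu> + 2 * t * \<mu> * (r \<bullet> w) + t\<^sup>2 * \<mu> * (norm r)\<^sup>2"
        by (simp add: norm_add_square w1 inner_commute power_mult_distrib algebra_simps)
      moreover have "r \<bullet> r = r \<bullet> (S *v w) - \<mu> * (r \<bullet> w)"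
        by (subst (2) r_def) (simp add: inner_diff_right)
      then have "r \<bullet> (S *v w) = r \<bullet> r + \<mu> * (r \<bullet> w)" by simp
      ultimately show ?thesis by (simp only: a_def) (simp add: algebra_simps)
    qed
    \<comment> \<open>Chosen so that the expression in \<open>exp\<close> collapses to t (r
      \<bullet> r) - t^2, which is negative for t < 0. The summand 1 keeps the denominator positive
      when a = 0.\<close>
    define t where "t = - (r \<bullet> r) / (1 + a)"
    have rr: "0 < r \<bullet> r" using \<open>r \<noteq> 0\<close> by simp
    have "t * (1 + a) = - (r \<bullet> r)" using a by (simp add: t_def)
    then have "2 * t * (r \<bullet> r) + t\<^sup>2 * a = t * (r \<bullet> r) - t\<^sup>2"
      by algebra
    moreover have "t < 0" using rr a by (simp add: t_def divide_neg_pos)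
    ultimately show False
      using exp[of t] mult_neg_pos[OF _ rr, of t] zero_le_power2[of t] by linarith
  qed
  then show thesis
    using that[of w \<mu>] wV w1 ge by (simp add: r_def)
qed

text \<open>The kernel of \<open>transpose A\<close> meets the range of A only in 0, so the smallest
  Rayleigh quotient \<mu> on that range is positive and is itself one of the eigenvalues over which
  the minimum is taken. The minimum is therefore at most \<mu>, and the bound for \<mu> carries
  over.\<close>

lemma min_pos_eigenvalue_gram:
  fixes A :: "real ^ 'd ^ 'n"
  assumes "A \<noteq> 0"
  shows "0 < min_pos_eigenvalue (A ** transpose A)"
    and "y \<in> range (\<lambda>u. A *v u) \<Longrightarrow>
      sqrt (min_pos_eigenvalue (A ** transpose A)) * norm y \<le> norm (transpose A *v y)"
proof -
  define S where "S = A ** transpose A"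
  define E where "E = {\<mu>. 0 < \<mu> \<and> (\<exists>w. w \<noteq> 0 \<and> S *v w = \<mu> *\<^sub>R w)}"
  define V where "V = range (\<lambda>u. A *v u)"
  have S: "S *v u = A *v (transpose A *v u)" for u
    unfolding S_def by (rule matrix_vector_mul_assoc[symmetric])
  have quad: "u \<bullet> (S *v u) = (norm (transpose A *v u))\<^sup>2" for u
    unfolding S power2_norm_eq_inner inner_transpose_matrix_vector ..
  have sym: "transpose S = S" by (simp add: S_def matrix_transpose_mul transpose_transpose)
  have finE: "finite E"
    by (rule finite_subset[OF _ finite_eigenvalues_symmetric[OF sym]]) (auto simp: E_def)
  obtain i j where "A $ i $ j \<noteq> 0" using assms by (auto simp: vec_eq_iff)
  then have "(A *v axis j 1) $ i \<noteq> 0"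
    by (simp add: matrix_vector_mul_component inner_axis)
  then have "A *v axis j 1 \<noteq> 0" by auto
  then have "V \<noteq> {0}" unfolding V_def by blast
  moreover have "subspace V"
    unfolding V_def by (rule linear_subspace_image) (auto simp: matrix_vector_mul_linear subspace_UNIV)
  moreover have "S *v u \<in> V" for u by (simp add: S V_def)
  ultimately obtain w \<mu> where w: "w \<in> V" "norm w = 1" "S *v w = \<mu> *\<^sub>R w"
    and ge: "\<And>u. u \<in> V \<Longrightarrow> \<mu> * (norm u)\<^sup>2 \<le> u \<bullet> (S *v u)"
    using rayleigh_minimum_eigenvector[OF sym] by metis
  have "transpose A *v w \<noteq> 0"
  proof
    assume 0: "transpose A *v w = 0"
    obtain u where "w = A *v u" using w(1) by (auto simp: V_def)
    then have "w \<bullet> w = 0" using inner_transpose_matrix_vector[of A w u] 0 by simp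
    then show False using w(2) by simp
  qed
  moreover have "\<mu> = (norm (transpose A *v w))\<^sup>2"
    using quad[of w] w by (simp add: dot_square_norm)
  ultimately have \<mu>E: "\<mu> \<in> E"
    using w by (auto simp: E_def intro!: exI[of _ w])
  have min: "min_pos_eigenvalue S = Min E" by (simp add: min_pos_eigenvalue_def E_def)
  have "Min E \<in> E" using Min_in finE \<mu>E by blast
  then show pos: "0 < min_pos_eigenvalue (A ** transpose A)"
    using min by (simp add: E_def S_def)
  assume "y \<in> range (\<lambda>u. A *v u)"
  then have "\<mu> * (norm y)\<^sup>2 \<le> (norm (transpose A *v y))\<^sup>2"
    using ge[of y] quad by (simp add: V_def)
  moreover have "Min E \<le> \<mu>" using finE \<mu>E by simp
  then have "Min E * (norm y)\<^sup>2 \<le> \<mu> * (norm y)\<^sup>2" by (intro mult_right_mono) auto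
  ultimately have "(sqrt (Min E) * norm y)\<^sup>2 \<le> (norm (transpose A *v y))\<^sup>2"
    using pos min by (simp add: power_mult_distrib S_def)
  then have "sqrt (Min E) * norm y \<le> norm (transpose A *v y)"
    by (rule power2_le_imp_le) simp
  then show "sqrt (min_pos_eigenvalue (A ** transpose A)) * norm y \<le> norm (transpose A *v y)"
    unfolding S_def[symmetric] min .
qed

section \<open>Gradients, Jacobians and the linearization error\<close>

lemma grad_works: "GDERIV \<phi> x :> D \<Longrightarrow> GDERIV \<phi> x :> grad \<phi> x"
  unfolding grad_def
proof (rule theI)
  fix D' assume D: "GDERIV \<phi> x :> D" "GDERIV \<phi> x :> D'"
  then have "(\<lambda>h. h \<bullet> D) = (\<lambda>h. h \<bullet> D')"
    unfolding gderiv_def by (rule has_derivative_unique)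
  from fun_cong[OF this, of "D - D'"] have "(D - D') \<bullet> (D - D') = 0" by (simp add: inner_diff_right)
  then show "D' = D" by simp
qed

lemma transpose_jacobian_mult:
  fixes g :: "real ^ 'd \<Rightarrow> real ^ 'm"
  assumes "\<And>i. GDERIV (\<lambda>u. g u $ i) x :> G i"
  shows "transpose (jacobian g (at x)) *v z = (\<Sum>i\<in>UNIV. z $ i *\<^sub>R G i)"
proof -
  have d: "(g has_derivative (\<lambda>h. \<chi> i. h \<bullet> G i)) (at x)"
  proof (subst has_derivative_componentwise_within, intro ballI)
    fix e :: "real ^ 'm" assume "e \<in> Basis"
    then obtain i where "e = axis i 1" by (auto simp: Basis_vec_def)
    then show "((\<lambda>u. g u \<bullet> e) has_derivative (\<lambda>h. (\<chi> i. h \<bullet> G i) \<bullet> e)) (at x)"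
      using assms[of i] by (simp add: inner_axis gderiv_def)
  qed
  have "jacobian g (at x) *v h = (\<chi> i. h \<bullet> G i)" for h
    unfolding jacobian_def frechet_derivative_at[OF d, symmetric]
    using matrix_vector_mul(2)[OF has_derivative_linear[OF d]] by meson
  then have "(transpose (jacobian g (at x)) *v z) \<bullet> h = (\<Sum>i\<in>UNIV. z $ i *\<^sub>R G i) \<bullet> h" for h
    unfolding inner_transpose_matrix_vector
    by (simp add: inner_vec_def[of z] inner_sum_left inner_sum_right inner_commute)
  then show ?thesis by (metis vector_eq_rdot)
qed

text \<open>Pairing with the residual r itself reduces the vector estimate to the monotonicity of
  one real function: \<open>\<phi> 1 \<le> \<phi> 0\<close> says that r \<bullet> r is at most |r|
  (L/2) |u - w|^2.\<close>

lemma lipschitz_jacobian_linearization: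
  fixes c :: "real ^ 'd \<Rightarrow> real ^ 'p"
  assumes diff: "\<And>u. c differentiable (at u)"
    and lip: "\<And>u w. norm (jacobian c (at u) - jacobian c (at w)) \<le> L * norm (u - w)"
  shows "norm (c u - (c w + jacobian c (at w) *v (u - w))) \<le> L / 2 * (norm (u - w))\<^sup>2"
proof -
  define d where "d = u - w"
  define J where "J t = jacobian c (at (w + t *\<^sub>R d))" for t
  define r where "r = c u - (c w + J 0 *v d)"
  define \<phi> where "\<phi> t = r \<bullet> (c (w + t *\<^sub>R d) - t *\<^sub>R (J 0 *v d)) - norm r * (L / 2 * t\<^sup>2 * (norm d)\<^sup>2)" for t
  have cderiv: "(c has_derivative (\<lambda>h. jacobian c (at u) *v h)) (at u)" for u
    using diff[of u] jacobian_works by blast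
  have deriv: "(\<phi> has_real_derivative r \<bullet> ((J t - J 0) *v d) - norm r * (L * t * (norm d)\<^sup>2)) (at t)" for t
  proof -
    have "((\<lambda>t. c (w + t *\<^sub>R d)) has_derivative (\<lambda>s. J t *v (s *\<^sub>R d))) (at t)"
      unfolding J_def
      by (rule has_derivative_compose[OF _ cderiv]) (auto intro!: derivative_eq_intros)
    then show ?thesis
      unfolding \<phi>_def has_field_derivative_def
      by (auto intro!: derivative_eq_intros simp: fun_eq_iff matrix_vector_mult_scaleR inner_diff_right
          matrix_vector_mult_diff_rdistrib algebra_simps)
  qed
  have "\<phi> 1 \<le> \<phi> 0"
  proof (rule DERIV_nonpos_imp_nonincreasing[of 0 1 \<phi>])
    fix t :: real assume t: "0 \<le> t" "t \<le> 1"
    have "r \<bullet> ((J t - J 0) *v d) \<le> norm r * norm ((J t - J 0) *v d)"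
      by (rule norm_cauchy_schwarz)
    also have "\<dots> \<le> norm r * (norm (J t - J 0) * norm d)"
      by (intro mult_left_mono norm_matrix_vector_mult_le) simp
    also have "\<dots> \<le> norm r * (L * norm (t *\<^sub>R d) * norm d)"
      using lip[of "w + t *\<^sub>R d" w] by (intro mult_left_mono mult_right_mono) (auto simp: J_def)
    also have "\<dots> = norm r * (L * t * (norm d)\<^sup>2)"
      using t by (simp add: power2_eq_square)
    finally show "\<exists>y. DERIV \<phi> t :> y \<and> y \<le> 0" using deriv by fastforce
  qed simp
  moreover have "r \<bullet> r = r \<bullet> (c (w + d) - J 0 *v d) - r \<bullet> c w"
    by (subst (2) r_def) (simp add: d_def inner_diff_right inner_add_right)
  ultimately have "norm r * norm r \<le> norm r * (L / 2 * (norm d)\<^sup>2)"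
    by (simp add: \<phi>_def dot_square_norm power2_eq_square)
  moreover have "0 \<le> L / 2 * (norm d)\<^sup>2"
  proof -
    have "0 \<le> L * norm d" using lip[of u w] norm_ge_zero order_trans unfolding d_def by blast
    then have "0 \<le> (L * norm d) * norm d" by (rule mult_nonneg_nonneg) simp
    then show ?thesis by (simp add: power2_eq_square mult.assoc)
  qed
  ultimately have "norm r \<le> L / 2 * (norm d)\<^sup>2"
    by (cases "r = 0") auto
  then show ?thesis by (simp add: r_def J_def d_def)
qed

section \<open>Stationarity of the proximal augmented Lagrangian\<close>

lemma has_derivative_affine: "((\<lambda>u. M *v u - b) has_derivative (\<lambda>h. M *v h)) (at x)"
  for M :: "real ^ 'd ^ 'n"
  by (rule has_derivative_eq_rhs[OF has_derivative_diff[OF bounded_linear_imp_has_derivative has_derivative_const]])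
     auto

lemma gderiv_inner_affine: "GDERIV (\<lambda>u. q \<bullet> (M *v u - b)) x :> transpose M *v q"
  for M :: "real ^ 'd ^ 'n"
  unfolding gderiv_def
  by (rule has_derivative_eq_rhs[OF has_derivative_inner_right[OF has_derivative_affine]])
     (simp add: fun_eq_iff inner_commute[of _ "q v* M"] dot_lmul_matrix)

lemma gderiv_square_affine:
  "GDERIV (\<lambda>u. a * (norm (M *v u - b))\<^sup>2) x :> (2 * a) *\<^sub>R (transpose M *v (M *v x - b))"
  for M :: "real ^ 'd ^ 'n"
  unfolding gderiv_def power2_norm_eq_inner
  by (rule has_derivative_eq_rhs[OF has_derivative_mult_right[OF
          has_derivative_inner[OF has_derivative_affine has_derivative_affine]]])
     (simp add: fun_eq_iff inner_commute[of _ "_ v* _"] dot_lmul_matrix inner_commute[of "M *v x - b"])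

lemma GDERIV_sum:
  "(\<And>i. i \<in> I \<Longrightarrow> GDERIV (\<phi> i) x :> G i) \<Longrightarrow> GDERIV (\<lambda>u. \<Sum>i\<in>I. \<phi> i u) x :> (\<Sum>i\<in>I. G i)"
  unfolding gderiv_def inner_sum_right by (rule has_derivative_sum)

lemma GDERIV_cmult: "GDERIV \<phi> x :> G \<Longrightarrow> GDERIV (\<lambda>u. a * \<phi> u) x :> a *\<^sub>R G"
  unfolding gderiv_def by (auto intro!: derivative_eq_intros simp: fun_eq_iff)

text \<open>With the next lemma this puts the squared positive part between its tangent and its
  tangent plus a square. The upper side yields a differentiable majorant, the lower side
  convexity.\<close>

lemma pos_part_square_upper: "(max 0 b)\<^sup>2 \<le> (max 0 a)\<^sup>2 + 2 * max 0 a * (b - a) + (b - a)\<^sup>2"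
  for a b :: real
proof -
  have "(max 0 a)\<^sup>2 + 2 * max 0 a * (b - a) + (b - a)\<^sup>2 = (max 0 a + (b - a))\<^sup>2"
    by (simp add: power2_eq_square algebra_simps)
  moreover have "(max 0 b)\<^sup>2 \<le> (max 0 a + (b - a))\<^sup>2"
    by (cases "0 \<le> b") (auto simp: max_def intro: power_mono)
  ultimately show ?thesis by simp
qed

lemma pos_part_square_lower: "(max 0 a)\<^sup>2 + 2 * max 0 a * (b - a) \<le> (max 0 b)\<^sup>2"
  for a b :: real
proof -
  have "0 \<le> (max 0 b - max 0 a)\<^sup>2" by simp
  then have "2 * max 0 a * max 0 b \<le> (max 0 b)\<^sup>2 + (max 0 a)\<^sup>2"
    by (simp add: power2_eq_square algebra_simps)
  moreover have "max 0 a * a = (max 0 a)\<^sup>2" "max 0 a * b \<le> max 0 a * max 0 b"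
    by (auto simp: max_def power2_eq_square mult_left_mono)
  ultimately show ?thesis by (simp add: algebra_simps)
qed

lemma norm_vec_square: "(norm (a :: real ^ 'm))\<^sup>2 = (\<Sum>i\<in>UNIV. (a $ i)\<^sup>2)"
  by (simp add: norm_vec_def L2_set_def sum_nonneg)

definition multiplier_eq ::
  "real ^ 'd ^ 'n \<Rightarrow> real ^ 'n \<Rightarrow> real \<Rightarrow> real ^ 'n \<Rightarrow> real ^ 'd \<Rightarrow> real ^ 'n" where
  "multiplier_eq A b \<beta> y x = y + \<beta> *\<^sub>R (A *v x - b)"

definition multiplier_ineq ::
  "(real ^ 'd \<Rightarrow> real ^ 'm) \<Rightarrow> real \<Rightarrow> real ^ 'm \<Rightarrow> real ^ 'd \<Rightarrow> real ^ 'm" where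
  "multiplier_ineq g \<beta> z x = pos_part (z + \<beta> *\<^sub>R g x)"

text \<open>The multiplier part of the augmented Lagrangian, split off so that it can be added to
  the true objective F instead of the smoothed model in the descent argument.\<close>

definition penalty ::
  "real ^ 'd ^ 'n \<Rightarrow> real ^ 'n \<Rightarrow> (real ^ 'd \<Rightarrow> real ^ 'm) \<Rightarrow> real \<Rightarrow> real ^ 'n \<Rightarrow> real ^ 'm
    \<Rightarrow> real ^ 'd \<Rightarrow> real" where
  "penalty A b g \<beta> y z u = y \<bullet> (A *v u - b) + \<beta> / 2 * (norm (A *v u - b))\<^sup>2
     + \<beta> / 2 * (norm (pos_part (g u + (1 / \<beta>) *\<^sub>R z)))\<^sup>2 - (norm z)\<^sup>2 / (2 * \<beta>)"

lemma multiplier_ineq_component: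
  "0 < \<beta> \<Longrightarrow> multiplier_ineq g \<beta> z x $ i = \<beta> * max 0 (g x $ i + z $ i / \<beta>)"
  by (auto simp: multiplier_ineq_def pos_part_def max_def field_simps)

lemma multiplier_ineq_nonneg: "0 \<le> multiplier_ineq g \<beta> z x $ i"
  by (simp add: multiplier_ineq_def pos_part_def)

section \<open>The composite problem, its convexity inequalities and the stationarity
  condition\<close>

locale composite_problem =
  fixes A :: "real ^ 'd ^ 'n" and b :: "real ^ 'n"
    and c :: "real ^ 'd \<Rightarrow> real ^ 'p" and l :: "real ^ 'p \<Rightarrow> real"
    and h :: "real ^ 'd \<Rightarrow> ereal" and g :: "real ^ 'd \<Rightarrow> real ^ 'm"
    and X :: "(real ^ 'd) set" and \<rho> L_g L_c M_l :: real
  assumes X_def: "X = effective_domain h"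
    and F_cont: "continuous_on X (\<lambda>u. ereal (l (c u)) + h u)"
    and X_compact: "compact X"
    and X_nonempty: "X \<noteq> {}"
    and rho_pos: "0 < \<rho>"
    and f_weakly_convex: "weakly_convex_on \<rho> X (\<lambda>u. l (c u))"
    and h_convex: "closed_convex_fun h"
    and g_convex_smooth: "\<And>i. \<exists>U. open U \<and> X \<subseteq> U \<and> convex_on U (\<lambda>u. g u $ i)
          \<and> L_smooth_on L_g U (\<lambda>u. g u $ i)"
    and c_smooth: "\<And>u. c differentiable (at u)"
    and c_jacobian_lip: "\<And>u w. norm (jacobian c (at u) - jacobian c (at w)) \<le> L_c * norm (u - w)"
    and l_convex: "convex_on UNIV l"
    and l_lipschitz: "M_l-lipschitz_on UNIV l"
    and rho_ge: "M_l * L_c \<le> \<rho>"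
begin

definition h_real :: "real ^ 'd \<Rightarrow> real" where
  "h_real u = real_of_ereal (h u)"

definition F_real :: "real ^ 'd \<Rightarrow> real" where
  "F_real u = l (c u) + h_real u"

definition G :: "'m \<Rightarrow> real ^ 'd \<Rightarrow> real ^ 'd" where
  "G i u = grad (\<lambda>w. g w $ i) u"

definition lin :: "real ^ 'd \<Rightarrow> real ^ 'd \<Rightarrow> real ^ 'p" where
  "lin x' u = c x' + jacobian c (at x') *v (u - x')"

abbreviation multiplier_force :: "real ^ 'n \<Rightarrow> real ^ 'm \<Rightarrow> real ^ 'd \<Rightarrow> real ^ 'd" where
  "multiplier_force y z x \<equiv> transpose A *v y + (\<Sum>i\<in>UNIV. z $ i *\<^sub>R G i x)"

lemma h_eq_real: "u \<in> X \<Longrightarrow> h u = ereal (h_real u)"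
  using h_convex X_def by (auto simp: h_real_def effective_domain_def closed_convex_fun_def ereal_real)

lemma h_outside: "u \<notin> X \<Longrightarrow> h u = \<infinity>"
  using X_def by (auto simp: effective_domain_def)

lemma convex_h_real: "convex_on X h_real"
proof -
  have comb: "s *\<^sub>R u + t *\<^sub>R w \<in> X \<and> h_real (s *\<^sub>R u + t *\<^sub>R w) \<le> s * h_real u + t * h_real w"
    if "u \<in> X" "w \<in> X" "0 \<le> s" "0 \<le> t" "s + t = 1" for u w s t
  proof -
    have "(u, h_real u) \<in> epi h" "(w, h_real w) \<in> epi h"
      using that h_eq_real by (auto simp: epi_def)
    then have "s *\<^sub>R (u, h_real u) + t *\<^sub>R (w, h_real w) \<in> epi h"
      using h_convex that by (intro convexD) (auto simp: closed_convex_fun_def)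
    then have le: "h (s *\<^sub>R u + t *\<^sub>R w) \<le> ereal (s * h_real u + t * h_real w)"
      by (simp add: epi_def)
    then have "s *\<^sub>R u + t *\<^sub>R w \<in> X"
      unfolding X_def effective_domain_def using order_le_less_trans by fastforce
    then show ?thesis using le h_eq_real by simp
  qed
  then have "convex X" by (auto simp: convex_def)
  then show ?thesis
    using comb by (auto simp: convex_on_def)
qed

lemma convex_F_real: "convex_on X (\<lambda>u. F_real u + \<rho> / 2 * (norm u)\<^sup>2)"
proof -
  have "convex_on X (\<lambda>u. (l (c u) + \<rho> / 2 * (norm u)\<^sup>2) + h_real u)"
    by (rule convex_on_add[OF f_weakly_convex[unfolded weakly_convex_on_def] convex_h_real])
  then show ?thesis by (simp add: F_real_def algebra_simps)
qed

lemma continuous_F_real: "continuous_on X F_real"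
proof -
  have "continuous_on X (\<lambda>u. ereal (F_real u))"
    using F_cont by (rule continuous_on_cong[THEN iffD1, rotated 2]) (auto simp: F_real_def h_eq_real)
  then show ?thesis by (simp add: continuous_on_iff_real o_def)
qed

lemma g_gderiv: "u \<in> X \<Longrightarrow> GDERIV (\<lambda>w. g w $ i) u :> G i u"
  using g_convex_smooth[of i] grad_works unfolding L_smooth_on_def G_def by blast

lemma g_gradient_ineq: "x \<in> X \<Longrightarrow> u \<in> X \<Longrightarrow> g x $ i + G i x \<bullet> (u - x) \<le> g u $ i"
  using g_convex_smooth[of i] convex_gradient_ineq[OF _ _ _ g_gderiv] by blast

lemma continuous_g: "continuous_on X (\<lambda>u. g u $ i)"
  using g_gderiv unfolding gderiv_def
  by (meson continuous_at_imp_continuous_on has_derivative_continuous)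

lemma subdifferential_h_real:
  assumes "\<eta> \<in> subdifferential h x"
  shows "x \<in> X" and "u \<in> X \<Longrightarrow> h_real x + \<eta> \<bullet> (u - x) \<le> h_real u"
proof -
  show x: "x \<in> X"
    using assms X_def by (auto simp: subdifferential_def effective_domain_def)
  assume u: "u \<in> X"
  have "h x + ereal (\<eta> \<bullet> (u - x)) \<le> h u"
    using assms by (simp add: subdifferential_def)
  then show "h_real x + \<eta> \<bullet> (u - x) \<le> h_real u"
    using h_eq_real[OF x] h_eq_real[OF u] by simp
qed

lemma lin_error: "\<bar>l (c u) - l (lin x' u)\<bar> \<le> \<rho> / 2 * (norm (u - x'))\<^sup>2"
proof -
  have "\<bar>l (c u) - l (lin x' u)\<bar> \<le> M_l * norm (c u - lin x' u)"
    using lipschitz_onD[OF l_lipschitz, of "c u" "lin x' u"] by (simp add: dist_norm)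
  also have "\<dots> \<le> M_l * (L_c / 2 * (norm (u - x'))\<^sup>2)"
    unfolding lin_def
    by (intro mult_left_mono lipschitz_jacobian_linearization[OF c_smooth c_jacobian_lip])
       (use l_lipschitz in \<open>simp add: lipschitz_on_def\<close>)
  also have "\<dots> \<le> \<rho> / 2 * (norm (u - x'))\<^sup>2"
    using mult_right_mono[OF rho_ge, of "(norm (u - x'))\<^sup>2 / 2"] by simp
  finally show ?thesis .
qed

lemma lagrangian_gradient_ineq:
  assumes "x \<in> X" "u \<in> X" "\<And>i. 0 \<le> z $ i"
  shows "y \<bullet> (A *v x - b) + z \<bullet> g x + multiplier_force y z x \<bullet> (u - x) \<le> y \<bullet> (A *v u - b) + z \<bullet> g u"
proof -
  have "(transpose A *v y) \<bullet> (u - x) = y \<bullet> (A *v u - b) - y \<bullet> (A *v x - b)"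
    unfolding inner_transpose_matrix_vector by (simp add: matrix_vector_mult_diff_distrib inner_diff_right)
  moreover have "z \<bullet> g x + (\<Sum>i\<in>UNIV. z $ i *\<^sub>R G i x) \<bullet> (u - x)
      = (\<Sum>i\<in>UNIV. z $ i * (g x $ i + G i x \<bullet> (u - x)))"
    by (simp add: inner_vec_def[of z] inner_sum_left sum.distrib distrib_left)
  moreover have "\<dots> \<le> z \<bullet> g u"
    unfolding inner_vec_def[of z] inner_real_def
    by (intro sum_mono mult_left_mono g_gradient_ineq assms)
  ultimately show ?thesis by (simp add: inner_add_left)
qed

text \<open>Each square lies above its tangent, whose slope is the full-step multiplier. The
  constraints are then linearized by convexity, which is possible because these multipliers are
  nonnegative on the inequalities.\<close>

lemma penalty_gradient_ineq:
  assumes x: "x \<in> X" and u: "u \<in> X" and \<beta>: "0 < \<beta>"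
  shows "penalty A b g \<beta> y z x
      + multiplier_force (multiplier_eq A b \<beta> y x) (multiplier_ineq g \<beta> z x) x \<bullet> (u - x)
    \<le> penalty A b g \<beta> y z u"
proof -
  let ?ye = "multiplier_eq A b \<beta> y x" and ?zi = "multiplier_ineq g \<beta> z x"
  have le: "?zi \<bullet> (g u - g x) \<le> \<beta> / 2 * (norm (pos_part (g u + (1 / \<beta>) *\<^sub>R z)))\<^sup>2
      - \<beta> / 2 * (norm (pos_part (g x + (1 / \<beta>) *\<^sub>R z)))\<^sup>2"
  proof -
    have "?zi $ i * (g u $ i - g x $ i) \<le> \<beta> / 2 * ((max 0 (g u $ i + z $ i / \<beta>))\<^sup>2
        - (max 0 (g x $ i + z $ i / \<beta>))\<^sup>2)" for i
      using mult_left_mono[OF pos_part_square_lower[of "g x $ i + z $ i / \<beta>" "g u $ i + z $ i / \<beta>"],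
          of "\<beta> / 2"] \<beta>
      by (simp add: multiplier_ineq_component algebra_simps)
    then have "(\<Sum>i\<in>UNIV. ?zi $ i * (g u $ i - g x $ i)) \<le> (\<Sum>i\<in>UNIV. \<beta> / 2 * ((max 0 (g u $ i + z $ i / \<beta>))\<^sup>2
        - (max 0 (g x $ i + z $ i / \<beta>))\<^sup>2))" by (intro sum_mono)
    then show ?thesis
      by (simp add: inner_vec_def[of ?zi] norm_vec_square pos_part_def sum_subtractf sum_distrib_left right_diff_distrib)
  qed
  have "?ye \<bullet> (A *v u - b) - ?ye \<bullet> (A *v x - b) \<le> y \<bullet> (A *v u - b) + \<beta> / 2 * (norm (A *v u - b))\<^sup>2
     - (y \<bullet> (A *v x - b) + \<beta> / 2 * (norm (A *v x - b))\<^sup>2)"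
  proof -
    define r s where "r = A *v x - b" and "s = A *v u - b"
    have "0 \<le> \<beta> / 2 * (norm (s - r))\<^sup>2" using \<beta> by simp
    then show ?thesis
      unfolding multiplier_eq_def r_def[symmetric] s_def[symmetric] power2_norm_eq_inner
      by (simp add: inner_commute algebra_simps)
  qed
  then show ?thesis
    using lagrangian_gradient_ineq[OF x u, of ?zi ?ye] le
    by (simp add: penalty_def multiplier_ineq_nonneg inner_diff_right)
qed

text \<open>The sum rule is applied not to the smooth part s of the augmented Lagrangian but to a
  majorant S that touches it at x. A subgradient of h + s at x is one of h + S as well, and S
  consists of terms whose gradients are explicit.\<close>

lemma stationarity:
  assumes \<xi>: "\<xi> \<in> subdifferential (prox_AL \<rho> \<nu> \<beta> l c h A b g x' y z) x"
    and \<nu>: "0 < \<nu>" and \<beta>: "0 < \<beta>"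
  obtains \<eta> q where "x \<in> X" "\<eta> \<in> subdifferential h x" "norm q \<le> M_l"
    "\<And>u. moreau_envelope \<nu> l (lin x' x) + (transpose (jacobian c (at x')) *v q) \<bullet> (u - x)
        \<le> moreau_envelope \<nu> l (lin x' u)"
    "\<xi> = transpose (jacobian c (at x')) *v q
        + multiplier_force (multiplier_eq A b \<beta> y x) (multiplier_ineq g \<beta> z x) x + \<rho> *\<^sub>R (x - x') + \<eta>"
proof -
  let ?J = "jacobian c (at x')" and ?zi = "multiplier_ineq g \<beta> z x"
  define s where "s u = moreau_envelope \<nu> l (lin x' u) + penalty A b g \<beta> y z u + \<rho> / 2 * (norm (u - x'))\<^sup>2" for u
  have AL: "prox_AL \<rho> \<nu> \<beta> l c h A b g x' y z u = ereal (s u) + h u" for u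
    by (simp add: prox_AL_def s_def penalty_def smoothed_model_def lin_def algebra_simps)
  have x: "x \<in> X"
    using \<xi> X_def AL by (auto simp: subdifferential_def effective_domain_def)
  have \<xi>_ineq: "h_real x + s x + \<xi> \<bullet> (u - x) \<le> h_real u + s u" if u: "u \<in> X" for u
  proof -
    have "ereal (s x) + h x + ereal (\<xi> \<bullet> (u - x)) \<le> ereal (s u) + h u"
      using \<xi> unfolding subdifferential_def AL by blast
    then show ?thesis using h_eq_real[OF x] h_eq_real[OF u] by simp
  qed
  obtain q where q: "norm q \<le> M_l"
    "\<And>w. moreau_envelope \<nu> l (lin x' x) + q \<bullet> (w - lin x' x) \<le> moreau_envelope \<nu> l w"
    "\<And>w. moreau_envelope \<nu> l w \<le> moreau_envelope \<nu> l (lin x' x) + q \<bullet> (w - lin x' x)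
       + 1 / (2 * \<nu>) * (norm (w - lin x' x))\<^sup>2"
    using moreau_envelope_gradient[OF l_convex l_lipschitz \<nu>] by blast
  have lin_diff: "lin x' u - lin x' x = ?J *v u - ?J *v x" for u
    by (simp add: lin_def matrix_vector_mult_diff_distrib)
  \<comment> \<open>The envelope is replaced by its quadratic upper bound and every squared positive
    part by tangent plus square. The added squares have zero gradient at x, so only first-order
    terms survive.\<close>
  define S where "S u = moreau_envelope \<nu> l (lin x' x) + (q \<bullet> (?J *v u - ?J *v x)
      + 1 / (2 * \<nu>) * (norm (?J *v u - ?J *v x))\<^sup>2)
    + (y \<bullet> (A *v u - b) + \<beta> / 2 * (norm (A *v u - b))\<^sup>2)
    + (\<Sum>i\<in>UNIV. \<beta> / 2 * (max 0 (g x $ i + z $ i / \<beta>))\<^sup>2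
        + ?zi $ i * (g u $ i - g x $ i) + \<beta> / 2 * ((g u $ i - g x $ i) * (g u $ i - g x $ i)))
    - (norm z)\<^sup>2 / (2 * \<beta>) + \<rho> / 2 * (norm (u - x'))\<^sup>2" for u
  have pen: "penalty A b g \<beta> y z u = y \<bullet> (A *v u - b) + \<beta> / 2 * (norm (A *v u - b))\<^sup>2
     + (\<Sum>i\<in>UNIV. \<beta> / 2 * (max 0 (g u $ i + z $ i / \<beta>))\<^sup>2) - (norm z)\<^sup>2 / (2 * \<beta>)" for u
    by (simp add: penalty_def norm_vec_square pos_part_def sum_distrib_left)
  have sS: "s x = S x" by (simp add: s_def S_def pen)
  have s_le_S: "s u \<le> S u" for u
  proof -
    have "\<beta> / 2 * (max 0 (g u $ i + z $ i / \<beta>))\<^sup>2 \<le> \<beta> / 2 * (max 0 (g x $ i + z $ i / \<beta>))\<^sup>2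
        + ?zi $ i * (g u $ i - g x $ i) + \<beta> / 2 * ((g u $ i - g x $ i) * (g u $ i - g x $ i))" for i
      using mult_left_mono[OF pos_part_square_upper[of "g u $ i + z $ i / \<beta>" "g x $ i + z $ i / \<beta>"],
          of "\<beta> / 2"] \<beta>
      by (simp add: multiplier_ineq_component power2_eq_square algebra_simps)
    then have "(\<Sum>i\<in>UNIV. \<beta> / 2 * (max 0 (g u $ i + z $ i / \<beta>))\<^sup>2)
       \<le> (\<Sum>i\<in>UNIV. \<beta> / 2 * (max 0 (g x $ i + z $ i / \<beta>))\<^sup>2
        + ?zi $ i * (g u $ i - g x $ i) + \<beta> / 2 * ((g u $ i - g x $ i) * (g u $ i - g x $ i)))"
      by (intro sum_mono)
    then show ?thesis
      using q(3)[of "lin x' u"] unfolding lin_diff s_def S_def pen by linarith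
  qed
  define G' where "G' = transpose ?J *v q + multiplier_force (multiplier_eq A b \<beta> y x) ?zi x + \<rho> *\<^sub>R (x - x')"
  have d1: "GDERIV (\<lambda>u. q \<bullet> (?J *v u - ?J *v x) + 1 / (2 * \<nu>) * (norm (?J *v u - ?J *v x))\<^sup>2) x
      :> transpose ?J *v q"
    using GDERIV_add[OF gderiv_inner_affine[of q ?J "?J *v x" x] gderiv_square_affine[of "1 / (2 * \<nu>)" ?J "?J *v x" x]]
    by simp
  have d2: "GDERIV (\<lambda>u. y \<bullet> (A *v u - b) + \<beta> / 2 * (norm (A *v u - b))\<^sup>2) x
      :> transpose A *v multiplier_eq A b \<beta> y x"
    by (rule GDERIV_subst[OF GDERIV_add[OF gderiv_inner_affine gderiv_square_affine]])
       (simp add: multiplier_eq_def vector_matrix_left_distrib scaleR_vector_matrix_assoc)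
  have d3: "GDERIV (\<lambda>u. \<Sum>i\<in>UNIV. \<beta> / 2 * (max 0 (g x $ i + z $ i / \<beta>))\<^sup>2
        + ?zi $ i * (g u $ i - g x $ i) + \<beta> / 2 * ((g u $ i - g x $ i) * (g u $ i - g x $ i))) x
      :> (\<Sum>i\<in>UNIV. ?zi $ i *\<^sub>R G i x)"
  proof (rule GDERIV_sum)
    fix i
    have g: "GDERIV (\<lambda>u. g u $ i - g x $ i) x :> G i x"
      by (rule GDERIV_subst[OF GDERIV_diff[OF g_gderiv[OF x] GDERIV_const]]) simp
    show "GDERIV (\<lambda>u. \<beta> / 2 * (max 0 (g x $ i + z $ i / \<beta>))\<^sup>2
        + ?zi $ i * (g u $ i - g x $ i) + \<beta> / 2 * ((g u $ i - g x $ i) * (g u $ i - g x $ i))) x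
      :> ?zi $ i *\<^sub>R G i x"
      by (rule GDERIV_subst[OF GDERIV_add[OF GDERIV_add[OF GDERIV_const GDERIV_cmult[OF g]]
              GDERIV_cmult[OF GDERIV_mult[OF g g]]]]) simp
  qed
  have d4: "GDERIV (\<lambda>u. \<rho> / 2 * (norm (u - x'))\<^sup>2) x :> \<rho> *\<^sub>R (x - x')"
    using gderiv_square_dist[of "\<rho> / 2" x' x] by simp
  have dS: "GDERIV S x :> G'"
    unfolding S_def
    by (rule GDERIV_subst[OF GDERIV_add[OF GDERIV_diff[OF GDERIV_add[OF GDERIV_add[OF
              GDERIV_add[OF GDERIV_const d1] d2] d3] GDERIV_const] d4]])
       (simp add: G'_def)
  have sub: "h_real x + (\<xi> - G') \<bullet> (u - x) \<le> h_real u" if u: "u \<in> X" for u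
  proof (rule subgradient_sum_rule[OF convex_h_real x u dS])
    fix w assume "w \<in> X"
    then show "h_real x + S x + \<xi> \<bullet> (w - x) \<le> h_real w + S w"
      using \<xi>_ineq[of w] s_le_S[of w] sS by linarith
  qed
  have "\<xi> - G' \<in> subdifferential h x"
  proof -
    have "h x + ereal ((\<xi> - G') \<bullet> (u - x)) \<le> h u" for u
      using sub[of u] h_eq_real[OF x] h_eq_real[of u] h_outside[of u] by (cases "u \<in> X") simp_all
    then show ?thesis using h_eq_real[OF x] by (simp add: subdifferential_def)
  qed
  moreover have "moreau_envelope \<nu> l (lin x' x) + (transpose ?J *v q) \<bullet> (u - x)
        \<le> moreau_envelope \<nu> l (lin x' u)" for u
    using q(2)[of "lin x' u"]
    by (simp only: lin_diff inner_transpose_matrix_vector matrix_vector_mult_diff_distrib)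
  moreover have "\<xi> = transpose ?J *v q + multiplier_force (multiplier_eq A b \<beta> y x) ?zi x
     + \<rho> *\<^sub>R (x - x') + (\<xi> - G')"
    by (simp add: G'_def)
  ultimately show thesis using that[OF x _ q(1)] by blast
qed

end

text \<open>If p' left the ball of radius T, then \<kappa> |p'| would exceed B and p' \<bullet> (p'
  - p) would be negative; but p lies in the ball, so by Cauchy-Schwarz this product is
  nonnegative.\<close>

lemma bounded_by_proximal_step:
  fixes p p' :: "'a::real_inner"
  assumes "p' \<bullet> (p' - p) / \<beta> + \<kappa> * norm p' \<le> B" "0 < \<beta>" "0 < \<kappa>" "norm p \<le> T" "B / \<kappa> \<le> T"
  shows "norm p' \<le> T"
proof (rule ccontr)
  assume *: "\<not> norm p' \<le> T"
  have "B \<le> T * \<kappa>" using assms by (simp add: field_simps)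
  moreover have "\<kappa> * T < \<kappa> * norm p'" using * assms(3) by simp
  ultimately have "p' \<bullet> (p' - p) / \<beta> < 0" using assms(1) by (simp add: mult.commute)
  then have "p' \<bullet> (p' - p) < 0" using assms(2) by (simp add: divide_less_0_iff)
  moreover have "p' \<bullet> p \<le> norm p' * norm p" by (rule norm_cauchy_schwarz)
  moreover have "norm p' * norm p \<le> norm p' * norm p'"
    using * assms(4) by (intro mult_left_mono) auto
  ultimately show False by (simp add: inner_diff_right dot_square_norm power2_eq_square)
qed

section \<open>Descent, the proximal Lagrangian and the multiplier estimate\<close>

context composite_problem
begin

text \<open>Testing stationarity at x' yields \<rho> |x - x'|^2 from the proximal term. The
  linearization is exact at x' and costs at most half of this at x.\<close>

lemma descent_step:
  assumes \<xi>: "\<xi> \<in> subdifferential (prox_AL \<rho> \<nu> \<beta> l c h A b g x' y z) x"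
    and \<nu>: "0 < \<nu>" and \<beta>: "0 < \<beta>" and x': "x' \<in> X"
  shows "F_real x + penalty A b g \<beta> y z x + \<rho> / 2 * (norm (x - x'))\<^sup>2
    \<le> F_real x' + penalty A b g \<beta> y z x' + norm \<xi> * norm (x - x') + \<nu> * M_l\<^sup>2 / 2"
proof -
  let ?m = "multiplier_force (multiplier_eq A b \<beta> y x) (multiplier_ineq g \<beta> z x) x"
  obtain \<eta> q where x: "x \<in> X" and \<eta>: "\<eta> \<in> subdifferential h x"
    and "norm q \<le> M_l"
    and q: "\<And>u. moreau_envelope \<nu> l (lin x' x) + (transpose (jacobian c (at x')) *v q) \<bullet> (u - x)
        \<le> moreau_envelope \<nu> l (lin x' u)"
    and eq: "\<xi> = transpose (jacobian c (at x')) *v q + ?m + \<rho> *\<^sub>R (x - x') + \<eta>"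
    by (rule stationarity[OF \<xi> \<nu> \<beta>], rule that)
  have "lin x' x' = c x'" by (simp add: lin_def)
  then have "moreau_envelope \<nu> l (lin x' x') \<le> l (c x')"
    using moreau_envelope_le[OF l_lipschitz \<nu>] by simp
  moreover have "l (lin x' x) - \<nu> * M_l\<^sup>2 / 2 \<le> moreau_envelope \<nu> l (lin x' x)"
    by (rule moreau_envelope_ge[OF l_lipschitz \<nu>])
  moreover have "\<xi> \<bullet> (x' - x) = (transpose (jacobian c (at x')) *v q) \<bullet> (x' - x) + ?m \<bullet> (x' - x)
      - \<rho> * (norm (x - x'))\<^sup>2 + \<eta> \<bullet> (x' - x)"
    unfolding eq power2_norm_eq_inner
    by (simp add: inner_add_left inner_diff_right inner_diff_left algebra_simps)
  moreover have "- (norm \<xi> * norm (x - x')) \<le> \<xi> \<bullet> (x' - x)"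
    using Cauchy_Schwarz_ineq2[of \<xi> "x' - x"] by (simp add: norm_minus_commute abs_le_iff)
  ultimately show ?thesis
    using q[of x'] penalty_gradient_ineq[OF x x' \<beta>, of y z] subdifferential_h_real(2)[OF \<eta> x']
      lin_error[of x x'] unfolding F_real_def by linarith
qed

text \<open>The weight is \<rho> rather than \<rho>/2: one half cancels the weak convexity of F, the
  other makes the function strongly convex when the multipliers z are nonnegative.\<close>

definition prox_lagrangian :: "real ^ 'n \<Rightarrow> real ^ 'm \<Rightarrow> real ^ 'd \<Rightarrow> real ^ 'd \<Rightarrow> real" where
  "prox_lagrangian y z x' u = F_real u + y \<bullet> (A *v u - b) + z \<bullet> g u + \<rho> * (norm (u - x'))\<^sup>2"

lemma prox_lagrangian_minimizer:
  assumes z: "\<And>i. 0 \<le> z $ i"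
  obtains w where "w \<in> X"
    "- multiplier_force y z w - (2 * \<rho>) *\<^sub>R (w - x') \<in> weak_subdifferential \<rho> (\<lambda>u. ereal (l (c u)) + h u) w"
    "\<And>u. u \<in> X \<Longrightarrow> prox_lagrangian y z x' w + \<rho> / 2 * (norm (u - w))\<^sup>2 \<le> prox_lagrangian y z x' u"
proof -
  have "continuous_on X (prox_lagrangian y z x')"
    unfolding prox_lagrangian_def inner_vec_def[of z]
    by (intro continuous_intros continuous_F_real matrix_vector_mult_linear_continuous_on continuous_g)
  then obtain w where w: "w \<in> X" and min: "\<And>u. u \<in> X \<Longrightarrow> prox_lagrangian y z x' w \<le> prox_lagrangian y z x' u"
    using continuous_attains_inf[OF X_compact X_nonempty] by blast
  define H where "H u = F_real u + \<rho> / 2 * (norm u)\<^sup>2" for u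
  \<comment> \<open>The last term takes back the quadratic that makes H convex; the form
    \<open>norm (u - 0)\<close> lets \<open>gderiv_square_dist\<close> apply to it.\<close>
  define S where "S u = y \<bullet> (A *v u - b) + (\<Sum>i\<in>UNIV. z $ i * g u $ i) + \<rho> * (norm (u - x'))\<^sup>2
     - \<rho> / 2 * (norm (u - 0))\<^sup>2" for u
  have PL: "prox_lagrangian y z x' u = H u + S u" for u
    by (simp add: prox_lagrangian_def H_def S_def inner_vec_def[of z])
  define D where "D = multiplier_force y z w + (2 * \<rho>) *\<^sub>R (w - x') - \<rho> *\<^sub>R w"
  have dS: "GDERIV S w :> D"
    unfolding S_def
    by (rule GDERIV_subst[OF GDERIV_diff[OF GDERIV_add[OF GDERIV_add[OF gderiv_inner_affine
          GDERIV_sum[OF GDERIV_cmult[OF g_gderiv[OF w]]]] gderiv_square_dist] gderiv_square_dist]])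
       (simp add: D_def)
  have H: "H w - D \<bullet> (u - w) \<le> H u" if "u \<in> X" for u
    using subgradient_sum_rule[OF convex_F_real w that dS, of 0] min PL by (simp add: H_def)
  have shift: "- multiplier_force y z w - (2 * \<rho>) *\<^sub>R (w - x') = - D - \<rho> *\<^sub>R w"
    by (simp add: D_def)
  have "- D \<in> subdifferential (\<lambda>u. (ereal (l (c u)) + h u) + ereal (\<rho> / 2 * (norm u)\<^sup>2)) w"
  proof -
    have eq: "(ereal (l (c u)) + h u) + ereal (\<rho> / 2 * (norm u)\<^sup>2) = ereal (H u)" if "u \<in> X" for u
      using h_eq_real[OF that] by (simp add: H_def F_real_def)
    have "ereal (H w) + ereal (- D \<bullet> (u - w)) \<le> (ereal (l (c u)) + h u) + ereal (\<rho> / 2 * (norm u)\<^sup>2)" for u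
    proof (cases "u \<in> X")
      case True
      then show ?thesis unfolding eq[OF True] using H[OF True] by simp
    qed (simp add: h_outside)
    then show ?thesis unfolding subdifferential_def eq[OF w] by simp
  qed
  then have "- D - \<rho> *\<^sub>R w \<in> weak_subdifferential \<rho> (\<lambda>u. ereal (l (c u)) + h u) w"
    unfolding weak_subdifferential_def by (rule imageI)
  then have "- multiplier_force y z w - (2 * \<rho>) *\<^sub>R (w - x') \<in> weak_subdifferential \<rho> (\<lambda>u. ereal (l (c u)) + h u) w"
    by (simp only: shift)
  moreover have "prox_lagrangian y z x' w + \<rho> / 2 * (norm (u - w))\<^sup>2 \<le> prox_lagrangian y z x' u"
    if u: "u \<in> X" for u
  proof -
    \<comment> \<open>Expanding both squares around w leaves exactly (\<rho>/2) |u - w|^2 beyond the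
      first-order terms, which is the strong convexity surplus.\<close>
    define r s where "r = (w - x') \<bullet> (u - w)" and "s = w \<bullet> (u - w)"
    have "(norm (u - x'))\<^sup>2 = (norm (u - w))\<^sup>2 + 2 * r + (norm (w - x'))\<^sup>2"
      using norm_add_square[of "u - w" "w - x'"] by (simp add: r_def inner_commute)
    moreover have "(norm u)\<^sup>2 = (norm (u - w))\<^sup>2 + 2 * s + (norm w)\<^sup>2"
      using norm_add_square[of "u - w" w] by (simp add: s_def inner_commute)
    moreover have "((2 * \<rho>) *\<^sub>R (w - x') - \<rho> *\<^sub>R w) \<bullet> (u - w) = 2 * \<rho> * r - \<rho> * s"
      by (simp only: r_def s_def inner_diff_left[of "_ *\<^sub>R _"] inner_scaleR_left)
    ultimately have "\<rho> * (norm (w - x'))\<^sup>2 - \<rho> / 2 * (norm w)\<^sup>2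
        + ((2 * \<rho>) *\<^sub>R (w - x') - \<rho> *\<^sub>R w) \<bullet> (u - w)
        + \<rho> / 2 * (norm (u - w))\<^sup>2 = \<rho> * (norm (u - x'))\<^sup>2 - \<rho> / 2 * (norm u)\<^sup>2"
      by (simp add: algebra_simps del: inner_diff_left inner_diff_right)
    moreover have "D \<bullet> (u - w) = multiplier_force y z w \<bullet> (u - w) + ((2 * \<rho>) *\<^sub>R (w - x') - \<rho> *\<^sub>R w) \<bullet> (u - w)"
      unfolding D_def by (simp add: inner_add_left inner_diff_left)
    ultimately show ?thesis
      using H[OF u] lagrangian_gradient_ineq[OF w u z, of y]
      unfolding prox_lagrangian_def H_def by linarith
  qed
  ultimately show thesis using that w by blast
qed

text \<open>The multipliers in PL are those of the stationarity condition at x, so the first-order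
  terms of both functions agree there. Half of the left-hand side comes from the strong convexity of
  PL at w, the other half from the proximal term of the augmented Lagrangian, after the
  linearization errors at w and x are paid.\<close>

lemma prox_lagrangian_gap:
  assumes \<xi>: "\<xi> \<in> subdifferential (prox_AL \<rho> \<nu> \<beta> l c h A b g x' y z) x"
    and \<nu>: "0 < \<nu>" and \<beta>: "0 < \<beta>" and w: "w \<in> X"
    and PL: "PL = prox_lagrangian (multiplier_eq A b \<beta> y x) (multiplier_ineq g \<beta> z x) x'"
    and min: "\<And>u. u \<in> X \<Longrightarrow> PL w + \<rho> / 2 * (norm (u - w))\<^sup>2 \<le> PL u"
  shows "\<rho> * (norm (x - w))\<^sup>2 \<le> norm \<xi> * norm (x - w) + \<rho> * (norm (x - x'))\<^sup>2 + \<nu> * M_l\<^sup>2 / 2"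
proof -
  let ?ye = "multiplier_eq A b \<beta> y x" and ?zi = "multiplier_ineq g \<beta> z x"
  let ?m = "multiplier_force ?ye ?zi x"
  obtain \<eta> q where x: "x \<in> X" and \<eta>: "\<eta> \<in> subdifferential h x"
    and "norm q \<le> M_l"
    and q: "\<And>u. moreau_envelope \<nu> l (lin x' x) + (transpose (jacobian c (at x')) *v q) \<bullet> (u - x)
        \<le> moreau_envelope \<nu> l (lin x' u)"
    and eq: "\<xi> = transpose (jacobian c (at x')) *v q + ?m + \<rho> *\<^sub>R (x - x') + \<eta>"
    by (rule stationarity[OF \<xi> \<nu> \<beta>], rule that)
  have "l (lin x' x) - \<nu> * M_l\<^sup>2 / 2 \<le> moreau_envelope \<nu> l (lin x' x)"
    by (rule moreau_envelope_ge[OF l_lipschitz \<nu>])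
  moreover have "moreau_envelope \<nu> l (lin x' w) \<le> l (lin x' w)"
    by (rule moreau_envelope_le[OF l_lipschitz \<nu>])
  moreover define r where "r = (x - x') \<bullet> (w - x)"
  moreover have "\<xi> \<bullet> (w - x) = (transpose (jacobian c (at x')) *v q) \<bullet> (w - x) + ?m \<bullet> (w - x)
      + \<rho> * r + \<eta> \<bullet> (w - x)"
    unfolding eq r_def by (simp only: inner_add_left inner_scaleR_left)
  moreover have "(norm (w - x'))\<^sup>2 = (norm (x - x'))\<^sup>2 + 2 * r + (norm (x - w))\<^sup>2"
    using norm_add_square[of "x - x'" "w - x"] by (simp add: r_def norm_minus_commute)
  then have "\<rho> / 2 * (norm (w - x'))\<^sup>2 = \<rho> / 2 * (norm (x - x'))\<^sup>2 + \<rho> * r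
      + \<rho> / 2 * (norm (x - w))\<^sup>2"
    by (simp add: algebra_simps)
  moreover have "- (norm \<xi> * norm (x - w)) \<le> \<xi> \<bullet> (w - x)"
    using Cauchy_Schwarz_ineq2[of \<xi> "w - x"] by (simp add: norm_minus_commute abs_le_iff)
  moreover have "PL w + \<rho> / 2 * (norm (x - w))\<^sup>2 \<le> PL x" by (rule min[OF x])
  ultimately show ?thesis
    using q[of w] lagrangian_gradient_ineq[OF x w multiplier_ineq_nonneg, of ?ye g \<beta> z x]
      subdifferential_h_real(2)[OF \<eta> w] lin_error[of w x'] lin_error[of x x']
    unfolding F_real_def PL prox_lagrangian_def by linarith
qed

text \<open>Complementarity: in each component the new multiplier is zero or its increment is
  exactly \<beta> g.\<close>

lemma multiplier_inner_step:
  assumes \<beta>: "0 < \<beta>"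
  shows "multiplier_ineq g \<beta> z x \<bullet> (multiplier_ineq g \<beta> z x - z) / \<beta>
    = multiplier_ineq g \<beta> z x \<bullet> g x"
proof -
  have "multiplier_ineq g \<beta> z x $ i * (multiplier_ineq g \<beta> z x $ i - z $ i) / \<beta>
      = multiplier_ineq g \<beta> z x $ i * g x $ i" for i
    using \<beta> by (auto simp: multiplier_ineq_def pos_part_def max_def)
  then show ?thesis by (simp add: inner_vec_def sum_divide_distrib)
qed

text \<open>Testing with x - x0 bounds the proximal product, the l1 norm Z of the inequality
  multipliers and the normal vector n at once. The equality multipliers stay in the range of A, so
  they are controlled through \<open>transpose A\<close>, which stationarity expresses by e, Z and
  n. The radius \<tau> is small enough for this second estimate to use only half of the Z term and
  the whole n term of the first.\<close>

lemma multiplier_bound_step: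
  assumes \<xi>: "\<xi> \<in> subdifferential (prox_AL \<rho> \<nu> \<beta> l c h A b g x' y z) x"
    and \<nu>: "0 < \<nu>" and \<beta>: "0 < \<beta>" and \<xi>1: "norm \<xi> \<le> 1"
    and A0: "A \<noteq> 0" and y: "y \<in> range (\<lambda>u. A *v u)"
    and feas_eq: "A *v x0 = b" and feas_ineq: "\<And>i. g x0 $ i \<le> - g_min"
    and feas_ball: "\<And>e. norm e \<le> R \<Longrightarrow> x0 + e \<in> X" and R: "0 \<le> R"
    and h_subdiff: "\<And>u. u \<in> X \<Longrightarrow> subdifferential h u \<subseteq> normal_cone X u + cball 0 r_h"
    and G_bound: "\<And>i u. u \<in> X \<Longrightarrow> norm (G i u) \<le> B_g"
    and dist0: "norm (x - x0) \<le> D" and dist': "norm (x - x') \<le> D"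
    and jac: "norm (jacobian c (at x')) \<le> dc"
    and \<tau>: "0 \<le> \<tau>" "\<tau> \<le> R" "\<tau> * B_g \<le> g_min / 2"
    and \<kappa>: "\<kappa> \<le> \<tau> * sqrt (min_pos_eigenvalue (A ** transpose A))" "\<kappa> \<le> g_min / 2" "0 \<le> \<kappa>"
    and p: "p = (multiplier_eq A b \<beta> y x, multiplier_ineq g \<beta> z x)"
  shows "p \<bullet> (p - (y, z)) / \<beta> + \<kappa> * norm p \<le> (D + \<tau>) * (1 + M_l * dc + r_h + \<rho> * D)"
proof -
  let ?ye = "multiplier_eq A b \<beta> y x" and ?zi = "multiplier_ineq g \<beta> z x"
  let ?J = "jacobian c (at x')" and ?GS = "\<Sum>i\<in>UNIV. multiplier_ineq g \<beta> z x $ i *\<^sub>R G i x"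
  define Z where "Z = (\<Sum>i\<in>UNIV. ?zi $ i)"
  define E where "E = 1 + M_l * dc + r_h + \<rho> * D"
  obtain \<eta> q where x: "x \<in> X" and \<eta>: "\<eta> \<in> subdifferential h x" and q: "norm q \<le> M_l"
    and "\<And>u. moreau_envelope \<nu> l (lin x' x) + (transpose ?J *v q) \<bullet> (u - x)
        \<le> moreau_envelope \<nu> l (lin x' u)"
    and eq: "\<xi> = transpose ?J *v q + (transpose A *v ?ye + ?GS) + \<rho> *\<^sub>R (x - x') + \<eta>"
    by (rule stationarity[OF \<xi> \<nu> \<beta>], rule that)
  obtain n w where nw: "\<eta> = n + w" "n \<in> normal_cone X x" "norm w \<le> r_h"
    using h_subdiff[OF x] \<eta> by (force elim!: set_plus_elim)
  \<comment> \<open>Collects everything in the stationarity condition that is bounded a priori,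
    unlike the multipliers and the normal vector.\<close>
  define e where "e = transpose ?J *v q + w + \<rho> *\<^sub>R (x - x') - \<xi>"
  have Aye: "transpose A *v ?ye = - e - ?GS - n"
    unfolding e_def using eq nw(1) by (simp add: algebra_simps)
  have Jq: "norm (transpose ?J *v q) \<le> M_l * dc"
  proof -
    have "(norm (transpose ?J *v q))\<^sup>2 = q \<bullet> (?J *v (transpose ?J *v q))"
      unfolding power2_norm_eq_inner inner_transpose_matrix_vector ..
    also have "\<dots> \<le> norm q * (norm ?J * norm (transpose ?J *v q))"
      by (rule order_trans[OF norm_cauchy_schwarz])
         (intro mult_left_mono norm_matrix_vector_mult_le norm_ge_zero)
    finally have "norm (transpose ?J *v q) \<le> norm q * norm ?J"
      by (cases "norm (transpose ?J *v q) = 0") (auto simp: power2_eq_square)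
    also have "\<dots> \<le> M_l * dc" using q jac by (intro mult_mono) (auto intro: order_trans[OF norm_ge_zero])
    finally show ?thesis .
  qed
  have e: "norm e \<le> E"
  proof -
    have "norm (\<rho> *\<^sub>R (x - x')) \<le> \<rho> * D" using dist' rho_pos by simp
    then show ?thesis
      unfolding e_def E_def using Jq nw(3) \<xi>1
        norm_triangle_ineq4[of "transpose ?J *v q + w + \<rho> *\<^sub>R (x - x')" \<xi>]
        norm_triangle_ineq[of "transpose ?J *v q + w" "\<rho> *\<^sub>R (x - x')"]
        norm_triangle_ineq[of "transpose ?J *v q" w] by linarith
  qed
  have D: "0 \<le> D" using dist0 norm_ge_zero order_trans by blast
  have E0: "0 \<le> E" using e norm_ge_zero order_trans by blast
  have Z0: "0 \<le> Z" unfolding Z_def by (intro sum_nonneg multiplier_ineq_nonneg)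
  \<comment> \<open>The point of the ball around x0 farthest in the direction n is still in X and
    therefore lies on the inner side of the supporting hyperplane at x.\<close>
  have cone: "R * norm n \<le> n \<bullet> (x - x0)"
  proof (cases "n = 0")
    case False
    have "x0 + (R / norm n) *\<^sub>R n \<in> X" using R False by (intro feas_ball) simp
    then have "n \<bullet> (x0 + (R / norm n) *\<^sub>R n - x) \<le> 0"
      using nw(2) by (auto simp: normal_cone_def split: if_splits)
    moreover have "n \<bullet> ((R / norm n) *\<^sub>R n) = R * norm n"
      using False by (simp add: dot_square_norm power2_eq_square)
    ultimately show ?thesis by (simp add: inner_add_right inner_diff_right)
  qed simp
  have x0: "x0 \<in> X" using feas_ball[of 0] R by simp
  have "?zi \<bullet> g x + g_min * Z \<le> ?GS \<bullet> (x - x0)"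
  proof -
    have "?zi $ i * g x $ i + g_min * ?zi $ i \<le> ?zi $ i * (G i x \<bullet> (x - x0))" for i
    proof -
      have "g x $ i + g_min \<le> G i x \<bullet> (x - x0)"
        using g_gradient_ineq[OF x x0, of i] feas_ineq[of i] by (simp add: inner_diff_right)
      from mult_left_mono[OF this multiplier_ineq_nonneg[of g \<beta> z x i]] show ?thesis
        by (simp add: distrib_left distrib_right mult.commute)
    qed
    then have "(\<Sum>i\<in>UNIV. ?zi $ i * g x $ i + g_min * ?zi $ i) \<le> (\<Sum>i\<in>UNIV. ?zi $ i * (G i x \<bullet> (x - x0)))"
      by (intro sum_mono)
    then show ?thesis
      by (simp add: inner_vec_def[of ?zi] inner_sum_left sum.distrib Z_def sum_distrib_left)
  qed
  moreover have "(transpose A *v ?ye) \<bullet> (x - x0) = ?ye \<bullet> (?ye - y) / \<beta>"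
  proof -
    have "?ye - y = \<beta> *\<^sub>R (A *v x - b)" by (simp add: multiplier_eq_def)
    then show ?thesis using \<beta> unfolding inner_transpose_matrix_vector
      by (simp add: matrix_vector_mult_diff_distrib feas_eq)
  qed
  moreover have "- (E * D) \<le> e \<bullet> (x - x0)"
  proof -
    have "norm e * norm (x - x0) \<le> E * D" using e dist0 E0 by (intro mult_mono) auto
    then show ?thesis using Cauchy_Schwarz_ineq2[of e "x - x0"] by linarith
  qed
  moreover have "(transpose A *v ?ye) \<bullet> (x - x0) = - (e \<bullet> (x - x0)) - ?GS \<bullet> (x - x0) - n \<bullet> (x - x0)"
    unfolding Aye by (simp add: inner_diff_left)
  ultimately have 1: "?ye \<bullet> (?ye - y) / \<beta> + ?zi \<bullet> g x + g_min * Z + R * norm n \<le> E * D"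
    using cone by linarith
  have b: "b \<in> range (\<lambda>u. A *v u)" using feas_eq by auto
  have "?ye \<in> range (\<lambda>u. A *v u)"
  proof -
    have "subspace (range (\<lambda>u. A *v u))"
      by (rule linear_subspace_image) (auto simp: matrix_vector_mul_linear subspace_UNIV)
    then show ?thesis unfolding multiplier_eq_def
      by (intro subspace_add subspace_scale subspace_diff y b) auto
  qed
  then have "\<tau> * (sqrt (min_pos_eigenvalue (A ** transpose A)) * norm ?ye) \<le> \<tau> * norm (transpose A *v ?ye)"
    using min_pos_eigenvalue_gram(2)[OF A0] \<tau>(1) by (intro mult_left_mono) auto
  also have "\<dots> \<le> \<tau> * (E + B_g * Z + norm n)"
  proof (intro mult_left_mono \<tau>)
    have "norm ?GS \<le> (\<Sum>i\<in>UNIV. ?zi $ i * B_g)"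
      using multiplier_ineq_nonneg[of g \<beta> z x] G_bound[OF x]
      by (intro order_trans[OF norm_sum] sum_mono) (simp add: mult_left_mono)
    also have "\<dots> = B_g * Z" by (simp add: Z_def sum_distrib_left mult.commute)
    finally show "norm (transpose A *v ?ye) \<le> E + B_g * Z + norm n"
      unfolding Aye using e norm_triangle_ineq4[of "- e - ?GS" n] norm_triangle_ineq4[of "- e" ?GS] by simp
  qed
  also have "\<dots> \<le> \<tau> * E + g_min / 2 * Z + R * norm n"
    using mult_right_mono[OF \<tau>(3) Z0] mult_right_mono[OF \<tau>(2) norm_ge_zero[of n]]
    by (simp add: algebra_simps)
  finally have 2: "\<tau> * sqrt (min_pos_eigenvalue (A ** transpose A)) * norm ?ye
      \<le> \<tau> * E + g_min / 2 * Z + R * norm n" by (simp add: mult.assoc)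
  have "norm ?zi \<le> Z"
    using norm_le_l1_cart[of ?zi] multiplier_ineq_nonneg[of g \<beta> z x] by (simp add: Z_def)
  then have "\<kappa> * norm ?zi \<le> g_min / 2 * Z"
    using \<kappa>(2,3) by (intro mult_mono) auto
  moreover have "\<kappa> * norm ?ye \<le> \<tau> * sqrt (min_pos_eigenvalue (A ** transpose A)) * norm ?ye"
    using \<kappa>(1) by (rule mult_right_mono) simp
  moreover have "\<kappa> * norm p \<le> \<kappa> * norm ?ye + \<kappa> * norm ?zi"
    using mult_left_mono[OF norm_Pair_le[of ?ye ?zi] \<kappa>(3)] unfolding p by (simp add: distrib_left)
  moreover have "p \<bullet> (p - (y, z)) / \<beta> = ?ye \<bullet> (?ye - y) / \<beta> + ?zi \<bullet> g x"
    unfolding p using multiplier_inner_step[OF \<beta>] by (simp add: inner_Pair add_divide_distrib)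
  moreover have "(D + \<tau>) * E = E * D + \<tau> * E" by (simp add: algebra_simps)
  ultimately show ?thesis
    using 1 2 unfolding E_def[symmetric] by (simp add: field_simps)
qed

end

section \<open>Drift of the penalty along the multiplier update\<close>

text \<open>The constraint value, cut off where a step of length \<beta> would make the multiplier
  negative.\<close>

definition slack ::
  "(real ^ 'd \<Rightarrow> real ^ 'm) \<Rightarrow> real \<Rightarrow> real ^ 'm \<Rightarrow> real ^ 'd \<Rightarrow> real ^ 'm" where
  "slack g \<beta> z x = (\<chi> i. max (- (z $ i) / \<beta>) (g x $ i))"

lemma multiplier_ineq_eq: "0 < \<beta> \<Longrightarrow> multiplier_ineq g \<beta> z x = z + \<beta> *\<^sub>R slack g \<beta> z x"
  by (auto simp: vec_eq_iff multiplier_ineq_def slack_def pos_part_def max_def field_simps)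

lemma multiplier_increment:
  assumes "0 < \<beta>"
  shows "(multiplier_eq A b \<beta> y x, multiplier_ineq g \<beta> z x) - (y, z) = \<beta> *\<^sub>R (A *v x - b, slack g \<beta> z x)"
  using assms by (simp add: multiplier_eq_def multiplier_ineq_eq)

lemma square_complete: "0 < \<beta> \<Longrightarrow> z * s + \<beta> / 2 * s\<^sup>2 = \<beta> / 2 * (s + z / \<beta>)\<^sup>2 - z\<^sup>2 / (2 * \<beta>)"
  for z s \<beta> :: real
  by (simp add: field_simps power2_eq_square)

text \<open>Each inequality term of the penalty is the minimum of \<open>z s + \<beta> s\<^sup>2 / 2\<close> over \<open>s \<ge> g\<close>,
  attained at the slack variable.\<close>

lemma penalty_le:
  assumes \<beta>: "0 < \<beta>" and s: "\<And>i. g x $ i \<le> s $ i"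
  shows "penalty A b g \<beta> y z x \<le> y \<bullet> (A *v x - b) + \<beta> / 2 * (norm (A *v x - b))\<^sup>2 + z \<bullet> s + \<beta> / 2 * (norm s)\<^sup>2"
proof -
  have "\<beta> / 2 * (max 0 (g x $ i + z $ i / \<beta>))\<^sup>2 - (z $ i)\<^sup>2 / (2 * \<beta>) \<le> z $ i * s $ i + \<beta> / 2 * (s $ i)\<^sup>2" for i
  proof -
    have "(max 0 (g x $ i + z $ i / \<beta>))\<^sup>2 \<le> (s $ i + z $ i / \<beta>)\<^sup>2"
      using s[of i] by (cases "0 \<le> g x $ i + z $ i / \<beta>") (auto simp: max_def intro!: power_mono)
    then show ?thesis unfolding square_complete[OF \<beta>] using \<beta> by (simp add: mult_left_mono)
  qed
  then have "(\<Sum>i\<in>UNIV. \<beta> / 2 * (max 0 (g x $ i + z $ i / \<beta>))\<^sup>2 - (z $ i)\<^sup>2 / (2 * \<beta>))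
      \<le> (\<Sum>i\<in>UNIV. z $ i * s $ i + \<beta> / 2 * (s $ i)\<^sup>2)" by (intro sum_mono)
  then show ?thesis
    by (simp add: penalty_def norm_vec_square[of z] norm_vec_square[of s] norm_vec_square[of "vec_lambda _"]
        pos_part_def inner_vec_def[of z] sum.distrib sum_subtractf sum_distrib_left sum_divide_distrib)
qed

lemma penalty_eq:
  assumes \<beta>: "0 < \<beta>"
  shows "penalty A b g \<beta> y z x = y \<bullet> (A *v x - b) + \<beta> / 2 * (norm (A *v x - b))\<^sup>2
    + z \<bullet> slack g \<beta> z x + \<beta> / 2 * (norm (slack g \<beta> z x))\<^sup>2"
proof -
  let ?s = "slack g \<beta> z x"
  have "\<beta> / 2 * (max 0 (g x $ i + z $ i / \<beta>))\<^sup>2 - (z $ i)\<^sup>2 / (2 * \<beta>) = z $ i * ?s $ i + \<beta> / 2 * (?s $ i)\<^sup>2" for i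
  proof -
    have "max 0 (g x $ i + z $ i / \<beta>) = ?s $ i + z $ i / \<beta>"
      by (auto simp: slack_def max_def)
    then show ?thesis unfolding square_complete[OF \<beta>] by simp
  qed
  then have "(\<Sum>i\<in>UNIV. \<beta> / 2 * (max 0 (g x $ i + z $ i / \<beta>))\<^sup>2 - (z $ i)\<^sup>2 / (2 * \<beta>))
      = (\<Sum>i\<in>UNIV. z $ i * ?s $ i + \<beta> / 2 * (?s $ i)\<^sup>2)" by simp
  then show ?thesis
    by (simp add: penalty_def norm_vec_square[of z] norm_vec_square[of "slack _ _ _ _"]
        norm_vec_square[of "vec_lambda _"] pos_part_def inner_vec_def[of z] sum.distrib
        sum_subtractf sum_distrib_left sum_divide_distrib)
qed

lemma norm_Pair_square: "(norm (a, b))\<^sup>2 = (norm a)\<^sup>2 + (norm b)\<^sup>2"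
  by (simp add: norm_Pair)

text \<open>In slack form the penalty is p0 \<bullet> d + (\<beta>/2) |d|^2 with p0 = (y, z) and p =
  p0 + \<beta> d, a difference of squares. It makes the penalty two-sidedly bounded as soon as the
  multipliers are.\<close>

lemma penalty_eq_multipliers:
  assumes \<beta>: "0 < \<beta>" and p: "p = (multiplier_eq A b \<beta> y x, multiplier_ineq g \<beta> z x)"
  shows "penalty A b g \<beta> y z x = ((norm p)\<^sup>2 - (norm (y, z))\<^sup>2) / (2 * \<beta>)"
proof -
  define d where "d = (A *v x - b, slack g \<beta> z x)"
  have "p = (y, z) + \<beta> *\<^sub>R d"
    using multiplier_increment[OF \<beta>, of A b y x g z] unfolding p d_def by (simp add: algebra_simps)
  then have "(norm p)\<^sup>2 - (norm (y, z))\<^sup>2 = 2 * \<beta> * ((y, z) \<bullet> d) + \<beta>\<^sup>2 * (norm d)\<^sup>2"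
    using \<beta> by (simp add: norm_add_square power_mult_distrib)
  then show ?thesis
    using \<beta> unfolding penalty_eq[OF \<beta>] d_def norm_Pair_square inner_Pair
    by (simp add: field_simps power2_eq_square)
qed

lemma damped_step_bounds:
  assumes "0 < \<beta>" "0 < v" "0 \<le> r"
  shows "0 \<le> damped_step \<beta> v r" "damped_step \<beta> v r \<le> \<beta>" "damped_step \<beta> v r * r \<le> v"
  using assms by (auto simp: damped_step_def min_def field_simps)

lemma feas_violation_le_increment:
  assumes \<beta>: "0 < \<beta>" and z: "\<And>i. 0 \<le> z $ i"
  shows "feas_violation A b g x \<le> norm (A *v x - b, slack g \<beta> z x)"
proof -
  have "norm (pos_part (g x)) \<le> norm (slack g \<beta> z x)"
  proof (rule norm_le_componentwise_cart)
    fix i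
    have "- (z $ i) / \<beta> \<le> 0" using z \<beta> by simp
    then show "norm (pos_part (g x) $ i) \<le> norm (slack g \<beta> z x $ i)"
      by (auto simp: pos_part_def slack_def max_def)
  qed
  then show ?thesis
    unfolding feas_violation_def norm_Pair by (simp add: power_mono)
qed

lemma norm_increment_le:
  assumes \<beta>: "0 < \<beta>" and "norm (y, z) \<le> B"
    and "norm (multiplier_eq A b \<beta> y x, multiplier_ineq g \<beta> z x) \<le> B"
  shows "norm (A *v x - b, slack g \<beta> z x) \<le> 2 * B / \<beta>"
proof -
  have "\<beta> * norm (A *v x - b, slack g \<beta> z x) \<le> 2 * B"
    using norm_triangle_ineq4[of "(multiplier_eq A b \<beta> y x, multiplier_ineq g \<beta> z x)" "(y, z)"] assms
    unfolding multiplier_increment[OF \<beta>] norm_scaleR by simp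
  then show ?thesis using \<beta> by (simp add: field_simps)
qed

text \<open>Of the summand with v, one half bounds \<alpha> times the squared infeasibility, the
  other the pairing of the positive part of g with z + z'; in both the damping gives \<alpha> times
  the infeasibility \<le> v. The other two summands telescope up to constants: the first covers
  inactive constraints, the second the growth of \<beta>.\<close>

lemma penalty_drift:
  assumes \<beta>: "0 < \<beta>" "\<beta> \<le> \<beta>'" and v: "0 < v" and z: "\<And>i. 0 \<le> z $ i"
    and B: "norm (y, z) \<le> B" "norm (y', z') \<le> B"
      "norm (multiplier_eq A b \<beta> y x, multiplier_ineq g \<beta> z x) \<le> B"
    and \<alpha>: "\<alpha> = damped_step \<beta> v (feas_violation A b g x)"
    and y': "y' = y + \<alpha> *\<^sub>R (A *v x - b)" and z': "z' = z + \<alpha> *\<^sub>R slack g \<beta> z x"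
  shows "penalty A b g \<beta>' y' z' x \<le> penalty A b g \<beta> y z x + 4 * B * (v / \<beta>)
    + ((norm z)\<^sup>2 - (norm z')\<^sup>2) / \<beta> + 2 * B\<^sup>2 * ((\<beta>' - \<beta>) / \<beta>\<^sup>2)"
proof -
  define r s where "r = A *v x - b" and "s = slack g \<beta> z x"
  define \<phi> where "\<phi> = feas_violation A b g x"
  have \<phi>0: "0 \<le> \<phi>" by (simp add: \<phi>_def feas_violation_def)
  have \<alpha>b: "0 \<le> \<alpha>" "\<alpha> \<le> \<beta>" "\<alpha> * \<phi> \<le> v"
    unfolding \<alpha> \<phi>_def[symmetric] using damped_step_bounds[OF \<beta>(1) v \<phi>0] by auto
  have B0: "0 \<le> B" using B(1) norm_ge_zero order_trans by blast
  have d: "norm (r, s) \<le> 2 * B / \<beta>"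
    unfolding r_def s_def by (rule norm_increment_le[OF \<beta>(1) B(1) B(3)])
  have \<phi>d: "\<phi> \<le> 2 * B / \<beta>"
    using d feas_violation_le_increment[OF \<beta>(1) z, of A b g x] unfolding \<phi>_def r_def s_def by linarith
  have gs: "g x $ i \<le> s $ i" for i by (simp add: s_def slack_def)
  \<comment> \<open>For a nonnegative slack, s equals the positive part of g, and the last term
    undoes the increase of z^2. For a negative one z falls, and since -s \<le> z / \<beta> and z'
    stays nonnegative, the decrease of z^2 already covers \<alpha> s^2.\<close>
  have comp: "\<alpha> * (s $ i)\<^sup>2 \<le> \<alpha> * (pos_part (g x) $ i)\<^sup>2 + ((z $ i)\<^sup>2 - (z' $ i)\<^sup>2) / \<beta>
      + \<alpha> / \<beta> * (pos_part (g x) $ i * (z + z') $ i)" for i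
  proof -
    have sge: "- (z $ i) / \<beta> \<le> s $ i" by (simp add: s_def slack_def)
    have zi: "z' $ i = z $ i + \<alpha> * s $ i" by (simp add: z' s_def)
    have diff: "((z $ i)\<^sup>2 - (z' $ i)\<^sup>2) / \<beta> = - (\<alpha> * s $ i * (z $ i + z' $ i) / \<beta>)"
      unfolding zi by (simp add: power2_eq_square algebra_simps add_divide_distrib diff_divide_distrib)
    show ?thesis
    proof (cases "0 \<le> s $ i")
      case True
      have "- (z $ i) / \<beta> \<le> 0" using z[of i] \<beta> by simp
      then have "pos_part (g x) $ i = s $ i"
        using True by (auto simp: s_def slack_def pos_part_def max_def split: if_splits)
      then show ?thesis unfolding diff by simp
    next
      case False
      then have g0: "pos_part (g x) $ i = 0" using gs[of i] by (simp add: pos_part_def)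
      have zs: "- (\<beta> * s $ i) \<le> z $ i" using sge \<beta> by (simp add: field_simps)
      have "\<beta> * s $ i \<le> \<alpha> * s $ i" using \<alpha>b False by (intro mult_right_mono_neg) auto
      then have z'0: "0 \<le> z' $ i" using zs unfolding zi by linarith
      have "(\<alpha> * - s $ i) * (- (\<beta> * s $ i)) \<le> (\<alpha> * - s $ i) * (z $ i + z' $ i)"
        using \<alpha>b False zs z'0 by (intro mult_left_mono mult_nonneg_nonneg) auto
      then have "\<alpha> * (s $ i)\<^sup>2 \<le> - (\<alpha> * s $ i * (z $ i + z' $ i) / \<beta>)"
        using \<beta> by (simp add: field_simps power2_eq_square)
      then show ?thesis unfolding diff g0 by simp
    qed
  qed
  have "\<alpha> * (norm s)\<^sup>2 \<le> \<alpha> * (norm (pos_part (g x)))\<^sup>2 + ((norm z)\<^sup>2 - (norm z')\<^sup>2) / \<beta>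
      + \<alpha> / \<beta> * (pos_part (g x) \<bullet> (z + z'))"
  proof -
    have "(\<Sum>i\<in>UNIV. \<alpha> * (s $ i)\<^sup>2) \<le> (\<Sum>i\<in>UNIV. \<alpha> * (pos_part (g x) $ i)\<^sup>2 + ((z $ i)\<^sup>2 - (z' $ i)\<^sup>2) / \<beta>
      + \<alpha> / \<beta> * (pos_part (g x) $ i * (z + z') $ i))" by (intro sum_mono comp)
    then show ?thesis
      unfolding norm_vec_square inner_vec_def inner_real_def sum.distrib sum_distrib_left[symmetric]
        sum_divide_distrib[symmetric] sum_subtractf by simp
  qed
  moreover have "\<alpha> / \<beta> * (pos_part (g x) \<bullet> (z + z')) \<le> 2 * B * (v / \<beta>)"
  proof -
    have "norm z \<le> B" "norm z' \<le> B"
      using B norm_snd_le[of z y] norm_snd_le[of z' y'] by auto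
    then have "norm (z + z') \<le> 2 * B" using norm_triangle_ineq[of z z'] by linarith
    moreover have "norm (pos_part (g x)) \<le> \<phi>" by (simp add: \<phi>_def feas_violation_def)
    ultimately have "pos_part (g x) \<bullet> (z + z') \<le> \<phi> * (2 * B)"
      by (intro order_trans[OF norm_cauchy_schwarz] mult_mono \<phi>0) auto
    then have "\<alpha> * (pos_part (g x) \<bullet> (z + z')) \<le> (\<alpha> * \<phi>) * (2 * B)"
      using \<alpha>b(1) by (simp add: mult.assoc mult_left_mono)
    also have "\<dots> \<le> v * (2 * B)" using \<alpha>b(3) B0 by (intro mult_right_mono) auto
    finally show ?thesis using \<beta>(1) by (simp add: field_simps)
  qed
  moreover have "\<alpha> * (norm r)\<^sup>2 + \<alpha> * (norm (pos_part (g x)))\<^sup>2 \<le> 2 * B * (v / \<beta>)"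
  proof -
    have "\<alpha> * (norm r)\<^sup>2 + \<alpha> * (norm (pos_part (g x)))\<^sup>2 = (\<alpha> * \<phi>) * \<phi>"
      by (simp add: \<phi>_def feas_violation_def r_def algebra_simps flip: power2_eq_square)
    also have "\<dots> \<le> v * (2 * B / \<beta>)" using \<alpha>b \<phi>d \<phi>0 v by (intro mult_mono) auto
    finally show ?thesis by (simp add: mult.commute)
  qed
  moreover have "(\<beta>' - \<beta>) / 2 * ((norm r)\<^sup>2 + (norm s)\<^sup>2) \<le> 2 * B\<^sup>2 * ((\<beta>' - \<beta>) / \<beta>\<^sup>2)"
  proof -
    have "(norm r)\<^sup>2 + (norm s)\<^sup>2 \<le> (2 * B / \<beta>)\<^sup>2"
      using power_mono[OF d norm_ge_zero, of 2] unfolding norm_Pair_square .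
    then have "(\<beta>' - \<beta>) / 2 * ((norm r)\<^sup>2 + (norm s)\<^sup>2) \<le> (\<beta>' - \<beta>) / 2 * (2 * B / \<beta>)\<^sup>2"
      using \<beta>(2) by (intro mult_left_mono) auto
    then show ?thesis by (simp add: power_divide power_mult_distrib mult.commute)
  qed
  \<comment> \<open>The old slack remains admissible for the new parameters, though no longer
    optimal; an upper bound is all that is wanted here.\<close>
  moreover have "penalty A b g \<beta>' y' z' x \<le> y' \<bullet> r + \<beta>' / 2 * (norm r)\<^sup>2 + z' \<bullet> s + \<beta>' / 2 * (norm s)\<^sup>2"
    unfolding r_def by (rule penalty_le) (use \<beta> gs in auto)
  moreover have "penalty A b g \<beta> y z x = y \<bullet> r + \<beta> / 2 * (norm r)\<^sup>2 + z \<bullet> s + \<beta> / 2 * (norm s)\<^sup>2"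
    unfolding r_def s_def by (rule penalty_eq[OF \<beta>(1)])
  moreover have "y' \<bullet> r = y \<bullet> r + \<alpha> * (norm r)\<^sup>2" "z' \<bullet> s = z \<bullet> s + \<alpha> * (norm s)\<^sup>2"
    unfolding y' z' r_def[symmetric] s_def[symmetric] power2_norm_eq_inner by (simp_all add: inner_add_left)
  moreover have "(\<beta>' - \<beta>) / 2 * ((norm r)\<^sup>2 + (norm s)\<^sup>2)
      = \<beta>' / 2 * (norm r)\<^sup>2 + \<beta>' / 2 * (norm s)\<^sup>2 - (\<beta> / 2 * (norm r)\<^sup>2 + \<beta> / 2 * (norm s)\<^sup>2)"
    by (simp add: algebra_simps diff_divide_distrib)
  ultimately show ?thesis by linarith
qed

lemma convex_combination_of_multipliers:
  fixes A :: "real ^ 'a ^ 'b" and g :: "real ^ 'a \<Rightarrow> real ^ 'c"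
  assumes \<beta>: "0 < \<beta>" and \<alpha>: "0 \<le> \<alpha>" "\<alpha> \<le> \<beta>"
    and B: "norm (y, z) \<le> B" "norm (multiplier_eq A b \<beta> y x, multiplier_ineq g \<beta> z x) \<le> B"
  shows "norm (y + \<alpha> *\<^sub>R (A *v x - b), z + \<alpha> *\<^sub>R slack g \<beta> z x) \<le> B"
proof -
  define t where "t = \<alpha> / \<beta>"
  have t: "0 \<le> t" "t \<le> 1" using \<alpha> \<beta> by (auto simp: t_def)
  have "(y + \<alpha> *\<^sub>R (A *v x - b), z + \<alpha> *\<^sub>R slack g \<beta> z x)
      = (1 - t) *\<^sub>R (y, z) + t *\<^sub>R (multiplier_eq A b \<beta> y x, multiplier_ineq g \<beta> z x)"
    using \<beta> by (simp add: multiplier_eq_def multiplier_ineq_eq t_def algebra_simps)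
  also have "norm \<dots> \<le> (1 - t) * B + t * B"
  proof -
    have "norm ((1 - t) *\<^sub>R p + t *\<^sub>R q) \<le> (1 - t) * B + t * B"
      if "norm p \<le> B" "norm q \<le> B" for p q :: "(real ^ 'b) \<times> (real ^ 'c)"
      using t that by (intro order_trans[OF norm_triangle_ineq] add_mono) (auto simp: mult_left_mono)
    then show ?thesis using B by blast
  qed
  finally show ?thesis by (simp add: algebra_simps)
qed

text \<open>The ratio v_k / \<beta>_k up to the factor v_0 / \<beta>_0. The value at 0 is set apart
  because the formula would divide by ln 1 = 0.\<close>

definition log_weight :: "nat \<Rightarrow> real" where
  "log_weight k = (if k = 0 then 1 else 1 / (real (k + 1) * (ln (real (k + 1)))\<^sup>2))"

lemma log_weight_nonneg: "0 \<le> log_weight k"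
  by (simp add: log_weight_def)

text \<open>A discrete integral test with the antiderivative -1 / ln, based on 1 / (a + 1) \<le> ln
  (a + 1) - ln a.\<close>

lemma log_weight_telescope:
  assumes "1 \<le> k"
  shows "log_weight (k + 1) \<le> 1 / ln (real (k + 1)) - 1 / ln (real (k + 2))"
proof -
  define a where "a = real (k + 1)"
  have a: "2 \<le> a" using assms by (simp add: a_def)
  have l: "0 < ln a" "0 < ln (a + 1)" "ln a \<le> ln (a + 1)" using a by auto
  have "ln (a / (a + 1)) \<le> a / (a + 1) - 1" using a by (intro ln_le_minus_one) auto
  then have "1 / (a + 1) \<le> ln (a + 1) - ln a" using a by (simp add: ln_div field_simps)
  then have "1 / (a + 1) / (ln (a + 1))\<^sup>2 \<le> (ln (a + 1) - ln a) / (ln a * ln (a + 1))"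
    using l a by (intro frac_le) (auto simp: power2_eq_square)
  also have "\<dots> = 1 / ln a - 1 / ln (a + 1)" using l by (simp add: field_simps)
  finally show ?thesis by (simp add: log_weight_def a_def add.commute)
qed

text \<open>The induction gives 4. The stated 11 is what C_x can absorb: 4 B_p * 11 = 10 (4 B_p) + 4
  B_p, and C_p exceeds 4 B_p.\<close>

lemma sum_log_weight: "(\<Sum>k<n. log_weight k) \<le> 11"
proof -
  have ln2: "2 / 3 \<le> ln (2::real)" by (rule ln2_ge_two_thirds)
  have bound: "(\<Sum>k<n + 2. log_weight k) \<le> 4 - 1 / ln (real (n + 2))" for n
  proof (induction n)
    case 0
    have "(2 / 3)\<^sup>2 \<le> (ln (2::real))\<^sup>2" using ln2 by (intro power_mono) auto
    then have "1 / (2 * (ln (2::real))\<^sup>2) \<le> 1 / (2 * (2 / 3)\<^sup>2)" by (intro frac_le) auto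
    moreover have "1 / ln (2::real) \<le> 1 / (2 / 3)" using ln2 by (intro frac_le) auto
    ultimately show ?case by (simp add: log_weight_def numeral_2_eq_2 power2_eq_square)
  next
    case (Suc n)
    then show ?case using log_weight_telescope[of "n + 1"] by (simp add: add.commute)
  qed
  have "(\<Sum>k<n. log_weight k) \<le> (\<Sum>k<n + 2. log_weight k)"
    by (intro sum_mono2) (auto simp: log_weight_nonneg)
  also have "\<dots> \<le> 4 - 1 / ln (real (n + 2))" by (rule bound)
  also have "\<dots> \<le> 11"
  proof -
    have "0 \<le> 1 / ln (real (n + 2))" by (intro divide_nonneg_nonneg ln_ge_zero) auto
    then show ?thesis by linarith
  qed
  finally show ?thesis .
qed

section \<open>From small steps to KKT points\<close>

text \<open>The stopping rule bounds an infimum; closedness turns it into an actual subgradient of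
  that norm.\<close>

lemma closed_subdifferential: "closed (subdifferential \<phi> x)"
proof (cases "\<bar>\<phi> x\<bar> = \<infinity>")
  case False
  then obtain a where a: "\<phi> x = ereal a" by auto
  have "closed {v. \<phi> x + ereal (v \<bullet> (u - x)) \<le> \<phi> u}" for u
  proof (cases "\<phi> u")
    case (real r)
    have "{v. \<phi> x + ereal (v \<bullet> (u - x)) \<le> \<phi> u} = {v. (u - x) \<bullet> v \<le> r - a}"
      using real a by (auto simp: inner_commute)
    then show ?thesis by (simp add: closed_halfspace_le)
  qed (simp_all add: a)
  then have "closed (\<Inter>u. {v. \<phi> x + ereal (v \<bullet> (u - x)) \<le> \<phi> u})" by blast
  moreover have "subdifferential \<phi> x = (\<Inter>u. {v. \<phi> x + ereal (v \<bullet> (u - x)) \<le> \<phi> u})"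
    using False by (auto simp: subdifferential_def)
  ultimately show ?thesis by simp
qed (simp add: subdifferential_def)

lemma edist_attained:
  fixes S :: "'a::euclidean_space set"
  assumes "closed S" and le: "edist 0 S \<le> ereal r"
  obtains v where "v \<in> S" "norm v \<le> r"
proof -
  have "S \<noteq> {}" using le by (auto simp: edist_def top_ereal_def)
  then obtain v where v: "v \<in> S" "infdist 0 S = dist 0 v"
    using infdist_attains_inf[OF \<open>closed S\<close>] by blast
  have "ereal (norm v) \<le> edist 0 S"
    unfolding edist_def
  proof (rule INF_greatest)
    fix w assume "w \<in> S"
    then show "ereal (norm v) \<le> ereal (dist 0 w)"
      using infdist_le[of w S 0] v(2) by simp
  qed
  from order_trans[OF this le] have "norm v \<le> r" by simp
  then show thesis using that v(1) by blast
qed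

lemma edist_le: "v \<in> S \<Longrightarrow> norm v \<le> r \<Longrightarrow> edist 0 S \<le> ereal r"
  unfolding edist_def by (rule INF_lower2[of v]) auto

lemma pos_part_nonexpansive: "\<bar>pos_part a $ i - pos_part b $ i\<bar> \<le> \<bar>a $ i - b $ i\<bar>"
  by (auto simp: pos_part_def max_def)

lemma inner_le_card_mult:
  fixes a :: "real ^ 'm"
  assumes "\<And>i. 0 \<le> a $ i" "\<And>i. \<bar>w i\<bar> \<le> t" "0 \<le> t"
  shows "(\<Sum>i\<in>UNIV. a $ i * \<bar>w i\<bar>) \<le> sqrt (real CARD('m)) * norm a * t"
proof -
  have "(\<Sum>i\<in>UNIV. a $ i * \<bar>w i\<bar>) \<le> (\<Sum>i\<in>UNIV. a $ i * t)"
    by (intro sum_mono mult_left_mono assms)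
  also have "\<dots> = (a \<bullet> 1) * t"
    by (simp add: inner_vec_def sum_distrib_right)
  also have "a \<bullet> 1 \<le> norm a * norm (1 :: real ^ 'm)" by (rule norm_cauchy_schwarz)
  also have "norm (1 :: real ^ 'm) = sqrt (real CARD('m))"
    by (simp add: norm_vec_def L2_set_def)
  finally show ?thesis using assms(3) by (simp add: mult.commute mult_right_mono)
qed

context composite_problem
begin

text \<open>The KKT point is w with the full-step multipliers formed at x. Infeasibility and
  complementarity get \<epsilon>/2 each from x, through the increment bound 2 B / \<beta>, and
  \<epsilon>/2 each from moving x to w.\<close>

lemma near_eps_KKT_of_small_step:
  assumes \<xi>: "\<xi> \<in> subdifferential (prox_AL \<rho> \<nu> \<beta> l c h A b g x' y z) x"
    and \<nu>: "0 < \<nu>" and \<beta>: "0 < \<beta>" and z: "\<And>i. 0 \<le> z $ i" and B_g: "0 \<le> B_g"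
    and g_lip: "\<And>i u w. u \<in> X \<Longrightarrow> w \<in> X \<Longrightarrow> \<bar>g u $ i - g w $ i\<bar> \<le> B_g * norm (u - w)"
    and B: "norm (y, z) \<le> B" "norm (multiplier_eq A b \<beta> y x, multiplier_ineq g \<beta> z x) \<le> B"
    and \<epsilon>: "0 < \<epsilon>" and e: "e = \<epsilon> / C"
    and C: "3 / 2 \<le> C" "3 / (4 * \<rho>) \<le> C"
      "3 / (2 * \<rho>) * sqrt ((spectral_norm A)\<^sup>2 + real CARD('m) * B_g\<^sup>2) \<le> C"
      "3 / (2 * \<rho>) * (sqrt (real CARD('m)) * B_g * B) \<le> C"
    and \<beta>_large: "4 * B \<le> \<epsilon> * \<beta>" "4 * B\<^sup>2 \<le> \<epsilon> * \<beta>"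
    and \<xi>_small: "norm \<xi> \<le> e / 16" and \<nu>_small: "\<rho> * (\<nu> * M_l\<^sup>2) \<le> e\<^sup>2 / 64"
    and step_small: "(\<rho> * norm (x - x'))\<^sup>2 \<le> 7 / 64 * e\<^sup>2"
  shows "near_eps_KKT \<rho> (\<lambda>u. ereal (l (c u)) + h u) A b g \<epsilon> x'"
proof -
  let ?F = "\<lambda>u. ereal (l (c u)) + h u"
  define ye zi where "ye = multiplier_eq A b \<beta> y x" and "zi = multiplier_ineq g \<beta> z x"
  have zi: "0 \<le> zi $ i" for i by (simp add: zi_def multiplier_ineq_nonneg)
  obtain w where w: "w \<in> X"
    and sub: "- multiplier_force ye zi w - (2 * \<rho>) *\<^sub>R (w - x') \<in> weak_subdifferential \<rho> ?F w"
    and min: "\<And>u. u \<in> X \<Longrightarrow> prox_lagrangian ye zi x' w + \<rho> / 2 * (norm (u - w))\<^sup>2 \<le> prox_lagrangian ye zi x' u"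
    by (rule prox_lagrangian_minimizer[of zi ye x', OF zi], rule that)
  have x: "x \<in> X" by (rule stationarity[OF \<xi> \<nu> \<beta>], assumption)
  define s where "s = norm (x - w)"
  have s0: "0 \<le> s" and e0: "0 < e" using C(1) \<epsilon> by (auto simp: s_def e)
  have B0: "0 \<le> B" using B(1) norm_ge_zero order_trans by blast
  have step: "\<rho> * norm (x - x') \<le> 3 / 8 * e"
  proof (rule power2_le_imp_le)
    show "(\<rho> * norm (x - x'))\<^sup>2 \<le> (3 / 8 * e)\<^sup>2"
    proof -
      have "(3 / 8 * e)\<^sup>2 = 9 / 64 * e\<^sup>2" by (simp add: power_mult_distrib power_divide)
      then show ?thesis using step_small zero_le_power2[of e] by linarith
    qed
  qed (use e0 in simp)
  have \<rho>s: "\<rho> * s \<le> 3 / 8 * e"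
  proof (rule ccontr)
    assume *: "\<not> \<rho> * s \<le> 3 / 8 * e"
    have "\<rho> * s\<^sup>2 \<le> norm \<xi> * s + \<rho> * (norm (x - x'))\<^sup>2 + \<nu> * M_l\<^sup>2 / 2"
      unfolding s_def by (rule prox_lagrangian_gap[OF \<xi> \<nu> \<beta> w refl min[unfolded ye_def zi_def]])
    also have "norm \<xi> * s \<le> e / 16 * s" using \<xi>_small s0 by (rule mult_right_mono)
    finally have "\<rho> * (\<rho> * s\<^sup>2) \<le> \<rho> * (e / 16 * s + \<rho> * (norm (x - x'))\<^sup>2 + \<nu> * M_l\<^sup>2 / 2)"
      using rho_pos by simp
    also have "\<dots> = e / 16 * (\<rho> * s) + (\<rho> * norm (x - x'))\<^sup>2 + \<rho> * (\<nu> * M_l\<^sup>2) / 2"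
      by (simp add: power2_eq_square algebra_simps)
    also have "\<rho> * (\<rho> * s\<^sup>2) = (\<rho> * s)\<^sup>2" by (simp add: power2_eq_square)
    finally have "(\<rho> * s)\<^sup>2 \<le> e / 16 * (\<rho> * s) + 15 / 128 * e\<^sup>2"
      using step_small \<nu>_small by linarith
    \<comment> \<open>The quadratic t^2 - t/16 - 15/128 has the roots 3/8 and -5/16; the 15/128 is
      7/64 from the step plus 1/128 from the smoothing.\<close>
    moreover have "0 < (\<rho> * s - 3 / 8 * e) * (\<rho> * s + 5 / 16 * e)"
      using * e0 by (intro mult_pos_pos) (auto intro: add_nonneg_pos mult_nonneg_nonneg simp: s0 less_imp_le[OF rho_pos])
    ultimately show False by (simp add: power2_eq_square algebra_simps)
  qed
  have dist_w: "\<rho> * norm (w - x') \<le> 3 / 4 * e"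
  proof -
    have "norm (w - x') \<le> s + norm (x - x')"
      using norm_triangle_ineq[of "w - x" "x - x'"] by (simp add: s_def norm_minus_commute)
    then have "\<rho> * norm (w - x') \<le> \<rho> * (s + norm (x - x'))" using rho_pos by simp
    then show ?thesis using step \<rho>s by (simp add: distrib_left)
  qed
  have eC: "e * C = \<epsilon>" using C(1) by (simp add: e)
  have near: "norm (x' - w) \<le> \<epsilon>"
  proof -
    have "e * (3 / (4 * \<rho>)) \<le> \<epsilon>" using mult_left_mono[OF C(2) less_imp_le[OF e0]] eC by simp
    moreover have "norm (w - x') \<le> e * (3 / (4 * \<rho>))" using dist_w rho_pos by (simp add: field_simps)
    ultimately show ?thesis by (simp add: norm_minus_commute)
  qed
  have stat: "edist 0 ((\<lambda>v. v + transpose (jacobian g (at w)) *v zi + transpose A *v ye)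
      ` weak_subdifferential \<rho> ?F w) \<le> ereal \<epsilon>"
  proof (rule edist_le[OF imageI[OF sub]])
    have "transpose (jacobian g (at w)) *v zi = (\<Sum>i\<in>UNIV. zi $ i *\<^sub>R G i w)"
      by (rule transpose_jacobian_mult[OF g_gderiv[OF w]])
    then have "- multiplier_force ye zi w - (2 * \<rho>) *\<^sub>R (w - x') + transpose (jacobian g (at w)) *v zi + transpose A *v ye
        = - ((2 * \<rho>) *\<^sub>R (w - x'))"
      by (simp only:) (simp add: algebra_simps)
    then have "norm (- multiplier_force ye zi w - (2 * \<rho>) *\<^sub>R (w - x') + transpose (jacobian g (at w)) *v zi + transpose A *v ye)
        = 2 * (\<rho> * norm (w - x'))"
      using rho_pos by simp
    also have "\<dots> \<le> e * (3 / 2)" using dist_w by simp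
    also have "\<dots> \<le> e * C" using C(1) e0 by simp
    finally show "norm (- multiplier_force ye zi w - (2 * \<rho>) *\<^sub>R (w - x') + transpose (jacobian g (at w)) *v zi + transpose A *v ye) \<le> \<epsilon>"
      using eC by simp
  qed
  have incr: "norm (A *v x - b, slack g \<beta> z x) \<le> 2 * B / \<beta>"
    by (rule norm_increment_le[OF \<beta> B])
  have half: "t * s \<le> \<epsilon> / 2" if "3 / (2 * \<rho>) * t \<le> C" "0 \<le> t" for t
  proof -
    have "s \<le> e * (3 / 8 / \<rho>)" using \<rho>s rho_pos by (simp add: field_simps)
    then have "t * s \<le> t * (e * (3 / 8 / \<rho>))" using that(2) by (rule mult_left_mono)
    also have "\<dots> = e / 4 * (3 / (2 * \<rho>) * t)" by simp
    also have "\<dots> \<le> e / 4 * C" using that(1) e0 by (intro mult_left_mono) auto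
    also have "\<dots> \<le> \<epsilon> / 2" using eC \<epsilon> by simp
    finally show ?thesis .
  qed
  have feas: "feas_violation A b g w \<le> \<epsilon>"
  proof -
    let ?r = "\<lambda>u. (A *v u - b, pos_part (g u))"
    have fv: "feas_violation A b g u = norm (?r u)" for u by (simp add: feas_violation_def norm_Pair)
    have "norm (?r w - ?r x) \<le> sqrt ((spectral_norm A)\<^sup>2 + real CARD('m) * B_g\<^sup>2) * s"
    proof (rule power2_le_imp_le)
      have "?r w - ?r x = (A *v (w - x), pos_part (g w) - pos_part (g x))"
        by (simp add: matrix_vector_mult_diff_distrib)
      moreover have "(norm (A *v (w - x)))\<^sup>2 \<le> (spectral_norm A * s)\<^sup>2"
        using norm_matrix_vector_mult_le_spectral[of A "w - x"]
        by (intro power_mono) (auto simp: s_def norm_minus_commute)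
      moreover have "(norm (pos_part (g w) - pos_part (g x)))\<^sup>2 \<le> real CARD('m) * (B_g * s)\<^sup>2"
      proof -
        have "((pos_part (g w) - pos_part (g x)) $ i)\<^sup>2 \<le> (B_g * s)\<^sup>2" for i
        proof -
          have "\<bar>pos_part (g w) $ i - pos_part (g x) $ i\<bar> \<le> B_g * s"
            using pos_part_nonexpansive[of "g w" i "g x"] g_lip[OF w x, of i]
            by (simp add: s_def norm_minus_commute)
          then show ?thesis using power_mono[OF _ abs_ge_zero, of _ "B_g * s" 2] by fastforce
        qed
        then have "(\<Sum>i\<in>UNIV. ((pos_part (g w) - pos_part (g x)) $ i)\<^sup>2) \<le> (\<Sum>i\<in>(UNIV :: 'm set). (B_g * s)\<^sup>2)"
          by (intro sum_mono)
        then show ?thesis by (simp add: norm_vec_square)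
      qed
      ultimately show "(norm (?r w - ?r x))\<^sup>2 \<le> (sqrt ((spectral_norm A)\<^sup>2 + real CARD('m) * B_g\<^sup>2) * s)\<^sup>2"
        by (simp add: norm_Pair_square power_mult_distrib algebra_simps)
    qed (use s0 in simp)
    also have "\<dots> \<le> \<epsilon> / 2" by (rule half[OF C(3)]) simp
    finally have "norm (?r w - ?r x) \<le> \<epsilon> / 2" .
    moreover have "feas_violation A b g x \<le> \<epsilon> / 2"
    proof -
      have "2 * B / \<beta> \<le> \<epsilon> / 2" using \<beta>_large(1) \<beta> by (simp add: field_simps)
      then show ?thesis using feas_violation_le_increment[OF \<beta> z, of A b g x] incr by linarith
    qed
    moreover have "norm (?r w) \<le> norm (?r x) + norm (?r w - ?r x)"
      using norm_triangle_ineq[of "?r x" "?r w - ?r x"] by simp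
    ultimately show ?thesis unfolding fv by linarith
  qed
  have compl: "(\<Sum>i\<in>UNIV. \<bar>zi $ i * g w $ i\<bar>) \<le> \<epsilon>"
  proof -
    have "norm zi \<le> B" using B(2) norm_snd_le[of zi ye] unfolding ye_def zi_def by simp
    have "\<bar>zi $ i * g w $ i\<bar> \<le> zi $ i * \<bar>slack g \<beta> z x $ i\<bar> + zi $ i * \<bar>g w $ i - g x $ i\<bar>" for i
    proof -
      \<comment> \<open>Where the multiplier is positive the cut-off in the slack is inactive, so
        the complementarity product at x is governed by the multiplier increment.\<close>
      have "zi $ i = 0 \<or> slack g \<beta> z x $ i = g x $ i"
        using \<beta> by (auto simp: zi_def multiplier_ineq_def pos_part_def slack_def max_def field_simps split: if_splits)
      then have "zi $ i * g w $ i = zi $ i * slack g \<beta> z x $ i + zi $ i * (g w $ i - g x $ i)"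
        by (auto simp: algebra_simps)
      then show ?thesis
        using abs_triangle_ineq[of "zi $ i * slack g \<beta> z x $ i" "zi $ i * (g w $ i - g x $ i)"] zi[of i]
        by (simp add: abs_mult)
    qed
    then have "(\<Sum>i\<in>UNIV. \<bar>zi $ i * g w $ i\<bar>)
        \<le> (\<Sum>i\<in>UNIV. zi $ i * \<bar>slack g \<beta> z x $ i\<bar>) + (\<Sum>i\<in>UNIV. zi $ i * \<bar>g w $ i - g x $ i\<bar>)"
      unfolding sum.distrib[symmetric] by (intro sum_mono)
    moreover have "(\<Sum>i\<in>UNIV. zi $ i * \<bar>slack g \<beta> z x $ i\<bar>) \<le> \<epsilon> / 2"
    proof -
      have "(\<Sum>i\<in>UNIV. zi $ i * \<bar>slack g \<beta> z x $ i\<bar>) = zi \<bullet> (\<chi> i. \<bar>slack g \<beta> z x $ i\<bar>)"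
        by (simp add: inner_vec_def)
      also have "\<dots> \<le> norm zi * norm (\<chi> i. \<bar>slack g \<beta> z x $ i\<bar>)" by (rule norm_cauchy_schwarz)
      also have "norm (\<chi> i. \<bar>slack g \<beta> z x $ i\<bar>) = norm (slack g \<beta> z x)"
        by (simp add: norm_vec_def)
      also have "norm zi * norm (slack g \<beta> z x) \<le> B * (2 * B / \<beta>)"
        using \<open>norm zi \<le> B\<close> B0 incr norm_snd_le[of "slack g \<beta> z x" "A *v x - b"]
        by (intro mult_mono) auto
      also have "\<dots> \<le> \<epsilon> / 2" using \<beta>_large(2) \<beta> by (simp add: field_simps power2_eq_square)
      finally show ?thesis .
    qed
    moreover have "(\<Sum>i\<in>UNIV. zi $ i * \<bar>g w $ i - g x $ i\<bar>) \<le> \<epsilon> / 2"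
    proof -
      have "(\<Sum>i\<in>UNIV. zi $ i * \<bar>g w $ i - g x $ i\<bar>) \<le> sqrt (real CARD('m)) * norm zi * (B_g * s)"
        using g_lip[OF w x] B_g s0 by (intro inner_le_card_mult zi) (auto simp: s_def norm_minus_commute)
      also have "\<dots> \<le> sqrt (real CARD('m)) * B * (B_g * s)"
        using \<open>norm zi \<le> B\<close> B_g s0 by (intro mult_right_mono mult_left_mono) auto
      also have "\<dots> = sqrt (real CARD('m)) * B_g * B * s" by simp
      also have "\<dots> \<le> \<epsilon> / 2" by (rule half[OF C(4)]) (use B_g B0 in simp)
      finally show ?thesis .
    qed
    ultimately show ?thesis by linarith
  qed
  have "w \<in> effective_domain ?F" using h_eq_real[OF w] by (simp add: effective_domain_def)
  then have "eps_KKT \<rho> ?F A b g \<epsilon> w"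
    unfolding eps_KKT_def using stat feas compl zi by (intro conjI exI[of _ ye] exI[of _ zi]) auto
  then show ?thesis unfolding near_eps_KKT_def using near by blast
qed

end

section \<open>Distance from the Slater point to the boundary\<close>

lemma cball_infdist_frontier_subset:
  fixes X :: "'a::euclidean_space set"
  assumes "closed X" "x \<in> X" and e: "norm e \<le> infdist x (frontier X)"
  shows "x + e \<in> X"
proof (rule ccontr)
  assume *: "x + e \<notin> X"
  have "closed_segment x (x + e) \<inter> frontier X \<noteq> {}"
    by (rule connected_Int_frontier) (use assms(2) * in auto)
  then obtain t where t: "0 \<le> t" "t \<le> 1" "(1 - t) *\<^sub>R x + t *\<^sub>R (x + e) \<in> frontier X"
    by (auto simp: in_segment)
  then have f: "x + t *\<^sub>R e \<in> frontier X" by (simp add: algebra_simps)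
  \<comment> \<open>A crossing at the endpoint would put x + e into the closed set X. Excluding it
    makes the crossing strictly closer than e, which admits equality in the hypothesis on e.\<close>
  then have "t \<noteq> 1" using * frontier_subset_closed[OF \<open>closed X\<close>] by auto
  then have "t * norm e < norm e" using t * assms(2) by (cases "e = 0") auto
  moreover have "infdist x (frontier X) \<le> t * norm e"
    using infdist_le[OF f, of x] t by (simp add: dist_norm)
  ultimately show False using e by linarith
qed

lemma infdist_frontier_pos:
  fixes X :: "'a::euclidean_space set"
  assumes "compact X" "x \<in> interior X"
  shows "0 < infdist x (frontier X)"
proof -
  have "X \<noteq> {}" using assms(2) interior_subset by blast
  moreover have "X \<noteq> UNIV" using assms(1) not_compact_UNIV by blast
  ultimately have ne: "frontier X \<noteq> {}" by (simp add: frontier_eq_empty)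
  have "x \<notin> frontier X" using assms(2) by (simp add: frontier_def)
  then have "infdist x (frontier X) \<noteq> 0"
    using in_closed_iff_infdist_zero[OF frontier_closed ne] by blast
  then show ?thesis using infdist_nonneg[of x "frontier X"] by simp
qed

section \<open>Iteration complexity\<close>

theorem theorem3:
  fixes A :: "real ^ 'd ^ 'n" and b :: "real ^ 'n"
    and c :: "real ^ 'd \<Rightarrow> real ^ 'p" and l :: "real ^ 'p \<Rightarrow> real"
    and f :: "real ^ 'd \<Rightarrow> real" and h F :: "real ^ 'd \<Rightarrow> ereal"
    and g :: "real ^ 'd \<Rightarrow> real ^ 'm"
    and X :: "(real ^ 'd) set" and x_feas :: "real ^ 'd"
    and x :: "nat \<Rightarrow> real ^ 'd" and y :: "nat \<Rightarrow> real ^ 'n" and z :: "nat \<Rightarrow> real ^ 'm"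
    and \<alpha> \<beta> v :: "nat \<Rightarrow> real"
    and \<epsilon> \<nu> \<rho> L_g L_c M_l r_h B_g \<beta>_0 v_0 D g_min dc B_f dist_bd :: real
    and \<tau> B_bar \<theta> B_p Q C_1 C_p_hat C_p C_x C_4 C_5 :: real
    and eps :: "nat \<Rightarrow> real"
  assumes eps_pos: "0 < \<epsilon>"
    and A_nonzero: "A \<noteq> 0"
    and f_def: "f = l \<circ> c"
    and F_def: "F = (\<lambda>u. ereal (f u) + h u)"
    and X_def: "X = effective_domain F"
    and F_cont: "continuous_on X F"
    and X_compact: "compact X"
    and D_def: "D = diameter X"
    and rho_pos: "0 < \<rho>"
    and f_weakly_convex: "weakly_convex_on \<rho> X f"
    and h_convex: "closed_convex_fun h"
    and g_convex_smooth: "\<And>i. \<exists>U. open U \<and> X \<subseteq> U \<and> convex_on U (\<lambda>u. g u $ i)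
          \<and> L_smooth_on L_g U (\<lambda>u. g u $ i)"
    and x_feas_int: "x_feas \<in> interior X"
    and x_feas_eq: "A *v x_feas = b"
    and g_min_def: "g_min = Min (range (\<lambda>i. - (g x_feas $ i)))"
    and g_min_pos: "0 < g_min"
    and r_h_pos: "0 < r_h"
    and h_subdiff: "\<And>u. u \<in> X \<Longrightarrow> subdifferential h u \<noteq> {}
          \<and> subdifferential h u \<subseteq> normal_cone X u + cball 0 r_h"
    \<comment> \<open>here the norm on matrices is the Frobenius norm\<close>
    and c_smooth: "\<And>u. c differentiable (at u)"
    and c_jacobian_lip: "\<And>u w. norm (jacobian c (at u) - jacobian c (at w)) \<le> L_c * norm (u - w)"
    and l_convex: "convex_on UNIV l"
    and M_l_pos: "0 < M_l"
    and l_lipschitz: "M_l-lipschitz_on UNIV l"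
    and rho_ge: "M_l * L_c \<le> \<rho>"
    \<comment> \<open>the bound on the constraint functions\<close>
    and B_g_pos: "0 < B_g"
    and B_g_bound: "\<And>i u. u \<in> X \<Longrightarrow> max \<bar>g u $ i\<bar> (norm (grad (\<lambda>w. g w $ i) u)) \<le> B_g"
    and B_g_lip: "\<And>i u w. u \<in> X \<Longrightarrow> w \<in> X \<Longrightarrow> \<bar>g u $ i - g w $ i\<bar> \<le> B_g * norm (u - w)"
    \<comment> \<open>the constants\<close>
    and dc_def: "dc = norm (jacobian c (at x_feas)) + L_c * D"
    and B_f_def: "B_f = M_l * dc"
    and dist_bd_def: "dist_bd = infdist x_feas (frontier X)"
    and tau_def: "\<tau> = min (g_min / (2 * sqrt (real CARD('m)) * B_g)) dist_bd"
    and B_bar_def: "B_bar = D * (r_h + B_f) + 2 * \<rho> * D\<^sup>2 + D + \<tau> * (1 + r_h + B_f + 2 * \<rho> * D)"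
    and theta_def: "\<theta> = B_bar / min (\<tau> * sqrt (min_pos_eigenvalue (A ** transpose A))) (g_min / 2)"
    and B_p_def: "B_p = max (norm (y 0, z 0)) \<theta>"
    and Q_def: "Q = D * (B_f + 2 * \<rho> * D + r_h)"
    and C_1_def: "C_1 = 1 / D + 1 / dist_bd + B_g / g_min"
    and C_p_hat_def: "C_p_hat = 2 * (B_p + sqrt (Q\<^sup>2 / g_min\<^sup>2
          + Q\<^sup>2 * (spectral_norm (pseudoinverse (A ** transpose A) ** A))\<^sup>2 * C_1\<^sup>2)) + 1"
    and C_p_def: "C_p = 2 * C_p_hat"
    and C_x_def: "C_x = 2 * (SUP u\<in>X. \<bar>real_of_ereal (F u)\<bar>)
          + 1 / (4 * \<beta>_0) * (14 * C_p\<^sup>2 + 8 * B_p * C_p + 7 * B_p\<^sup>2)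
          + (10 * C_p + 4 * B_p) * (v_0 / \<beta>_0)
          + \<beta>_0 / 2 * ((norm (A *v x 0 - b))\<^sup>2
              + (norm (pos_part (g (x 0) + (1 / \<beta>_0) *\<^sub>R z 0)))\<^sup>2)
          + \<bar>y 0 \<bullet> (A *v x 0 - b)\<bar>"
    and C_5_def: "C_5 = max (4 * C_p\<^sup>2 / \<beta>_0\<^sup>2) (4 * (B_p\<^sup>2 + 5 * C_p\<^sup>2 / 2)\<^sup>2 / \<beta>_0\<^sup>2)"
    and C_4_def: "C_4 = Max {3 / 2,
          3 / (2 * \<rho>) * sqrt ((spectral_norm A)\<^sup>2 + real CARD('m) * B_g\<^sup>2),
          4 * B_g / \<rho> * sqrt (real CARD('m) * \<beta>_0 * sqrt C_5),
          64 / \<rho>\<^sup>2 * real CARD('m) * B_g\<^sup>2 * \<beta>_0 * sqrt (\<rho> * C_x),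
          8 * B_g / \<rho> * sqrt (real CARD('m) * \<beta>_0),
          3 / (4 * \<rho>)}"
    \<comment> \<open>the parameters and iterates of the method\<close>
    and beta_0_pos: "0 < \<beta>_0"
    and v_0_pos: "0 < v_0"
    and beta_def: "\<And>k. \<beta> k = \<beta>_0 * sqrt (real (k + 1))"
    and v_at_0: "v 0 = v_0"
    and v_def: "\<And>k. 1 \<le> k \<Longrightarrow> v k = v_0 / (sqrt (real (k + 1)) * (ln (real (k + 1)))\<^sup>2)"
    and eps_def: "\<And>k. eps k = min (\<epsilon> / (16 * C_4)) (min (sqrt (\<rho> / (2 * \<beta> k))) 1)"
    and nu_def: "\<nu> = min 1 (\<epsilon>\<^sup>2 / (64 * C_4\<^sup>2 * \<rho> * M_l\<^sup>2))"
    and x_init: "x 0 \<in> X"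
    and y_init: "y 0 \<in> range (\<lambda>u. A *v u)"
    and z_init: "\<And>i. 0 \<le> z 0 $ i"
    and x_step: "\<And>k. edist 0 (subdifferential (prox_AL \<rho> \<nu> (\<beta> k) l c h A b g (x k) (y k) (z k))
          (x (k + 1))) \<le> ereal (eps k)"
    and alpha_def: "\<And>k. \<alpha> k = damped_step (\<beta> k) (v k) (feas_violation A b g (x (k + 1)))"
    and y_step: "\<And>k. y (k + 1) = y k + \<alpha> k *\<^sub>R (A *v x (k + 1) - b)"
    and z_step: "\<And>k. z (k + 1) = z k + \<alpha> k *\<^sub>R (\<chi> i. max (- (z k $ i) / \<beta> k) (g (x (k + 1)) $ i))"
  shows "\<exists>k. int k \<le> \<lceil>C_5 / \<epsilon>\<^sup>2\<rceil> + \<lceil>64 * \<rho> * C_x * C_4\<^sup>2 / \<epsilon>\<^sup>2\<rceil>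
          \<and> near_eps_KKT \<rho> F A b g \<epsilon> (x k)"
proof -
  have F_eq: "F = (\<lambda>u. ereal (l (c u)) + h u)" by (simp add: F_def f_def)
  have X_h: "X = effective_domain h"
    unfolding X_def F_eq by (auto simp: effective_domain_def)
  have x_feas: "x_feas \<in> X" using x_feas_int interior_subset by blast
  interpret P: composite_problem A b c l h g X \<rho> L_g L_c M_l
    by unfold_locales
      (use X_h F_cont[unfolded F_eq] X_compact x_feas rho_pos f_weakly_convex h_convex g_convex_smooth
        c_smooth c_jacobian_lip l_convex l_lipschitz rho_ge in \<open>auto simp: f_def o_def\<close>)
  have G_bound: "\<And>i u. u \<in> X \<Longrightarrow> norm (P.G i u) \<le> B_g"
    using B_g_bound by (simp add: P.G_def)
  have \<beta>pos: "0 < \<beta> k" for k unfolding beta_def using beta_0_pos by simp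
  have v_weight: "v k / \<beta> k = v_0 / \<beta>_0 * log_weight k" for k
    by (cases "k = 0") (auto simp: v_at_0 v_def beta_def log_weight_def)
  have v_pos: "0 < v k" for k
  proof (cases "k = 0")
    case False
    then have "0 < ln (real (k + 1))" by simp
    then show ?thesis using False v_0_pos by (simp add: v_def)
  qed (simp add: v_at_0 v_0_pos)

  have C_4: "3 / 2 \<le> C_4"
    "3 / (2 * \<rho>) * sqrt ((spectral_norm A)\<^sup>2 + real CARD('m) * B_g\<^sup>2) \<le> C_4"
    "4 * B_g / \<rho> * sqrt (real CARD('m) * \<beta>_0 * sqrt C_5) \<le> C_4"
    "3 / (4 * \<rho>) \<le> C_4"
    unfolding C_4_def by (rule Max_ge; simp)+
  define e where "e = \<epsilon> / C_4"
  have e_pos: "0 < e" using C_4(1) eps_pos by (simp add: e_def)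
  have e2: "e\<^sup>2 = \<epsilon>\<^sup>2 / C_4\<^sup>2" by (simp add: e_def power_divide)
  have \<nu>_pos: "0 < \<nu>" using C_4(1) eps_pos rho_pos M_l_pos by (simp add: nu_def)
  have \<nu>_small: "\<rho> * (\<nu> * M_l\<^sup>2) \<le> e\<^sup>2 / 64"
  proof -
    have "\<nu> \<le> \<epsilon>\<^sup>2 / (64 * C_4\<^sup>2 * \<rho> * M_l\<^sup>2)" by (simp add: nu_def)
    then have "\<rho> * (\<nu> * M_l\<^sup>2) \<le> \<rho> * (\<epsilon>\<^sup>2 / (64 * C_4\<^sup>2 * \<rho> * M_l\<^sup>2) * M_l\<^sup>2)"
      using rho_pos by (intro mult_left_mono mult_right_mono) auto
    also have "\<dots> = e\<^sup>2 / 64" using rho_pos M_l_pos by (simp add: e2)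
    finally show ?thesis .
  qed
  have eps_le: "eps k \<le> e / 16" "eps k \<le> 1" for k
    by (simp_all add: eps_def e_def)

  \<comment> \<open>Bounds on the data and the Slater radius\<close>
  have D_bound: "norm (u - w) \<le> D" if "u \<in> X" "w \<in> X" for u w
    using diameter_bounded_bound[OF compact_imp_bounded[OF X_compact] that] by (simp add: D_def dist_norm)
  have D0: "0 \<le> D" using D_bound[OF x_feas x_feas] by simp
  have L_c0: "0 \<le> L_c"
  proof -
    \<comment> \<open>Any coordinate direction supplies two points at distance one, where the
      Lipschitz bound reads 0 \<le> L_c.\<close>
    obtain i :: 'd where True by simp
    have "0 \<le> L_c * norm (axis i (1::real) - 0)"
      using c_jacobian_lip[of "axis i 1" 0] norm_ge_zero order_trans by blast
    then show ?thesis by (simp add: norm_axis_1)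
  qed
  have jac: "norm (jacobian c (at u)) \<le> dc" if "u \<in> X" for u
  proof -
    have "norm (jacobian c (at u)) \<le> norm (jacobian c (at x_feas)) + L_c * norm (u - x_feas)"
      using c_jacobian_lip[of u x_feas] norm_triangle_ineq2[of "jacobian c (at u)" "jacobian c (at x_feas)"]
      by linarith
    also have "L_c * norm (u - x_feas) \<le> L_c * D" using D_bound[OF that x_feas] L_c0 by (rule mult_left_mono)
    finally show ?thesis by (simp add: dc_def)
  qed
  have feas_ineq: "g x_feas $ i \<le> - g_min" for i
  proof -
    have "g_min \<le> - (g x_feas $ i)" unfolding g_min_def by (rule Min_le) auto
    then show ?thesis by simp
  qed
  have dist_pos: "0 < dist_bd" unfolding dist_bd_def by (rule infdist_frontier_pos[OF X_compact x_feas_int])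
  have feas_ball: "x_feas + e \<in> X" if "norm e \<le> dist_bd" for e
    using cball_infdist_frontier_subset[OF compact_imp_closed[OF X_compact] x_feas] that by (simp add: dist_bd_def)
  have tau_pos: "0 < \<tau>" using dist_pos g_min_pos B_g_pos by (simp add: tau_def)
  have tau_le: "\<tau> \<le> dist_bd" by (simp add: tau_def)
  have tau_B: "\<tau> * B_g \<le> g_min / 2"
  proof -
    have "\<tau> * B_g \<le> g_min / (2 * sqrt (real CARD('m)) * B_g) * B_g"
      using B_g_pos by (intro mult_right_mono) (auto simp: tau_def)
    also have "\<dots> = g_min / 2 / sqrt (real CARD('m))" using B_g_pos by simp
    also have "\<dots> \<le> g_min / 2 / 1" using g_min_pos by (intro divide_left_mono) (auto simp: Suc_le_eq)
    finally show ?thesis by simp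
  qed
  define \<kappa> where "\<kappa> = min (\<tau> * sqrt (min_pos_eigenvalue (A ** transpose A))) (g_min / 2)"
  have \<kappa>_pos: "0 < \<kappa>"
    using tau_pos min_pos_eigenvalue_gram(1)[OF A_nonzero] g_min_pos by (simp add: \<kappa>_def)
  have B_p0: "0 \<le> B_p" unfolding B_p_def by (simp add: le_max_iff_disj)
  have C_p: "4 * B_p + 2 \<le> C_p"
    unfolding C_p_def C_p_hat_def by simp

  have "\<exists>\<xi>. \<xi> \<in> subdifferential (prox_AL \<rho> \<nu> (\<beta> k) l c h A b g (x k) (y k) (z k)) (x (k + 1)) \<and> norm \<xi> \<le> eps k" for k
    using edist_attained[OF closed_subdifferential x_step] by blast
  then obtain \<xi> where \<xi>: "\<And>k. \<xi> k \<in> subdifferential (prox_AL \<rho> \<nu> (\<beta> k) l c h A b g (x k) (y k) (z k)) (x (k + 1))"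
    and \<xi>_eps: "\<And>k. norm (\<xi> k) \<le> eps k" by metis
  have xX1: "x (k + 1) \<in> X" for k
    by (rule P.stationarity[OF \<xi> \<nu>_pos \<beta>pos], assumption)
  have xX: "x k \<in> X" for k using xX1[of "k - 1"] x_init by (cases k) auto

  \<comment> \<open>Invariance of the multiplier ball\<close>
  define q where "q k = (multiplier_eq A b (\<beta> k) (y k) (x (k + 1)), multiplier_ineq g (\<beta> k) (z k) (x (k + 1)))" for k
  have z_slack: "z (k + 1) = z k + \<alpha> k *\<^sub>R slack g (\<beta> k) (z k) (x (k + 1))" for k
    unfolding z_step slack_def ..
  have fv0: "0 \<le> feas_violation A b g u" for u by (simp add: feas_violation_def)
  have \<alpha>b: "0 \<le> \<alpha> k" "\<alpha> k \<le> \<beta> k" for k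
    unfolding alpha_def by (rule damped_step_bounds[OF \<beta>pos v_pos fv0])+
  \<comment> \<open>Stated conditionally, since it is one half of the induction step for
    \<open>inv\<close>; the premises are discharged afterwards.\<close>
  have q_bound: "norm (q k) \<le> B_p" if y_range: "y k \<in> range (\<lambda>u. A *v u)" and "norm (y k, z k) \<le> B_p" for k
  proof (rule bounded_by_proximal_step[OF _ \<beta>pos \<kappa>_pos that(2)])
    show "q k \<bullet> (q k - (y k, z k)) / \<beta> k + \<kappa> * norm (q k) \<le> (D + \<tau>) * (1 + M_l * dc + r_h + \<rho> * D)"
    proof (rule P.multiplier_bound_step[OF \<xi> \<nu>_pos \<beta>pos order_trans[OF \<xi>_eps eps_le(2)] A_nonzero y_range
          x_feas_eq feas_ineq feas_ball less_imp_le[OF dist_pos] _ G_bound D_bound D_bound jac])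
      show "\<And>u. u \<in> X \<Longrightarrow> subdifferential h u \<subseteq> normal_cone X u + cball 0 r_h"
        using h_subdiff by blast
    qed (use xX xX1 x_feas tau_pos tau_le tau_B \<kappa>_pos in \<open>auto simp: \<kappa>_def q_def\<close>)
    have "(D + \<tau>) * (1 + M_l * dc + r_h + \<rho> * D) \<le> B_bar"
    proof -
      \<comment> \<open>B_bar carries 2 \<rho> D where the estimate yields \<rho> D, so the
        difference is nonnegative.\<close>
      have "B_bar - (D + \<tau>) * (1 + M_l * dc + r_h + \<rho> * D) = \<rho> * D\<^sup>2 + \<tau> * \<rho> * D"
        by (simp add: B_bar_def B_f_def power2_eq_square algebra_simps)
      then show ?thesis using rho_pos tau_pos D0 by (smt (verit) mult_nonneg_nonneg zero_le_power2)
    qed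
    then have "(D + \<tau>) * (1 + M_l * dc + r_h + \<rho> * D) / \<kappa> \<le> \<theta>"
      unfolding theta_def \<kappa>_def[symmetric] using \<kappa>_pos by (simp add: divide_right_mono)
    then show "(D + \<tau>) * (1 + M_l * dc + r_h + \<rho> * D) / \<kappa> \<le> B_p" by (simp add: B_p_def)
  qed
  have subA: "subspace (range (\<lambda>u. A *v u))"
    by (rule linear_subspace_image) (auto simp: matrix_vector_mul_linear subspace_UNIV)
  have inv: "y k \<in> range (\<lambda>u. A *v u) \<and> (\<forall>i. 0 \<le> z k $ i) \<and> norm (y k, z k) \<le> B_p" for k
  proof (induction k)
    case 0
    show ?case using y_init z_init by (simp add: B_p_def)
  next
    case (Suc k)
    have "b \<in> range (\<lambda>u. A *v u)" using x_feas_eq by auto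
    then have "y (k + 1) \<in> range (\<lambda>u. A *v u)"
      unfolding y_step using Suc by (intro subspace_add subspace_scale subspace_diff subA) auto
    moreover have "0 \<le> z (k + 1) $ i" for i
    proof -
      have "\<alpha> k * (- (z k $ i) / \<beta> k) \<le> \<alpha> k * max (- (z k $ i) / \<beta> k) (g (x (k + 1)) $ i)"
        using \<alpha>b by (intro mult_left_mono) auto
      moreover have "\<alpha> k * z k $ i \<le> \<beta> k * z k $ i" using \<alpha>b Suc by (intro mult_right_mono) auto
      then have "- (z k $ i) \<le> \<alpha> k * (- (z k $ i) / \<beta> k)" using \<beta>pos[of k] by (simp add: field_simps)
      ultimately show ?thesis unfolding z_step by simp
    qed
    moreover have "norm (y (k + 1), z (k + 1)) \<le> B_p"
      unfolding y_step z_slack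
      by (rule convex_combination_of_multipliers[OF \<beta>pos \<alpha>b]) (use Suc q_bound[of k] in \<open>auto simp: q_def\<close>)
    ultimately show ?case by simp
  qed
  have p_bound: "norm (y k, z k) \<le> B_p" and z_nonneg: "\<And>i. 0 \<le> z k $ i" and q_bound: "norm (q k) \<le> B_p" for k
    using inv q_bound by auto

  define S where "S = (SUP u\<in>X. \<bar>real_of_ereal (F u)\<bar>)"
  have F_bound: "\<bar>P.F_real u\<bar> \<le> S" if u: "u \<in> X" for u
  proof -
    have F_real: "real_of_ereal (F w) = P.F_real w" if "w \<in> X" for w
      using P.h_eq_real[OF that] by (simp add: F_eq P.F_real_def)
    have "bdd_above ((\<lambda>u. \<bar>P.F_real u\<bar>) ` X)"
      by (intro bounded_imp_bdd_above compact_imp_bounded compact_continuous_image[OF _ X_compact]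
          continuous_on_rabs P.continuous_F_real)
    then have "\<bar>P.F_real u\<bar> \<le> (SUP u\<in>X. \<bar>P.F_real u\<bar>)" using u by (rule cSUP_upper2) simp
    also have "\<dots> = S" unfolding S_def by (rule SUP_cong) (simp_all add: F_real)
    finally show ?thesis .
  qed

  \<comment> \<open>Energy, potential and total decrease\<close>
  define \<delta> where "\<delta> k = norm (x (k + 1) - x k)" for k
  define E where "E k = P.F_real (x (k + 1)) + penalty A b g (\<beta> k) (y k) (z k) (x (k + 1))" for k
  \<comment> \<open>The two potentials absorbing the drift through inactive constraints and through
    the growth of \<beta>. V moreover subtracts the accumulated damping terms, so it can increase
    only by the inexactness and smoothing errors.\<close>
  define T where "T k = (norm (z k))\<^sup>2 / \<beta> k + 4 * B_p\<^sup>2 / \<beta> k" for k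
  define V where "V k = E k + T k - 4 * B_p * (v_0 / \<beta>_0) * (\<Sum>j<k. log_weight j)" for k
  have \<beta>_mono: "\<beta> k \<le> \<beta> (k + 1)" and \<beta>_double: "\<beta> (k + 1) \<le> 2 * \<beta> k" for k
  proof -
    show "\<beta> k \<le> \<beta> (k + 1)" unfolding beta_def using beta_0_pos by (intro mult_left_mono) auto
    have "sqrt (real (k + 1 + 1)) \<le> sqrt (4 * real (k + 1))" by simp
    also have "\<dots> = 2 * sqrt (real (k + 1))" unfolding real_sqrt_mult by simp
    finally show "\<beta> (k + 1) \<le> 2 * \<beta> k" unfolding beta_def using beta_0_pos by simp
  qed
  have \<beta>_ge0: "\<beta>_0 \<le> \<beta> k" for k
    unfolding beta_def using beta_0_pos by (simp add: mult_le_cancel_left1)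
  have drift: "penalty A b g (\<beta> (k + 1)) (y (k + 1)) (z (k + 1)) (x (k + 1))
      \<le> penalty A b g (\<beta> k) (y k) (z k) (x (k + 1)) + 4 * B_p * (v_0 / \<beta>_0) * log_weight k + T k - T (k + 1)" for k
  proof -
    have "penalty A b g (\<beta> (k + 1)) (y (k + 1)) (z (k + 1)) (x (k + 1))
        \<le> penalty A b g (\<beta> k) (y k) (z k) (x (k + 1)) + 4 * B_p * (v k / \<beta> k)
          + ((norm (z k))\<^sup>2 - (norm (z (k + 1)))\<^sup>2) / \<beta> k + 2 * B_p\<^sup>2 * ((\<beta> (k + 1) - \<beta> k) / (\<beta> k)\<^sup>2)"
      by (rule penalty_drift[OF \<beta>pos \<beta>_mono v_pos z_nonneg p_bound p_bound q_bound[unfolded q_def] alpha_def y_step z_slack])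
    moreover have "(norm (z (k + 1)))\<^sup>2 / \<beta> (k + 1) \<le> (norm (z (k + 1)))\<^sup>2 / \<beta> k"
      using \<beta>_mono \<beta>pos by (intro divide_left_mono) auto
    moreover have "2 * B_p\<^sup>2 * ((\<beta> (k + 1) - \<beta> k) / (\<beta> k)\<^sup>2) \<le> 4 * B_p\<^sup>2 / \<beta> k - 4 * B_p\<^sup>2 / \<beta> (k + 1)"
    proof -
      \<comment> \<open>Since \<beta> at most doubles, its square is at least half the product of
        consecutive values, which turns the quotient into a telescoping difference.\<close>
      have "(\<beta> (k + 1) - \<beta> k) / (\<beta> k)\<^sup>2 \<le> (\<beta> (k + 1) - \<beta> k) / (\<beta> k * \<beta> (k + 1) / 2)"
        using \<beta>_mono[of k] \<beta>_double[of k] \<beta>pos[of k] \<beta>pos[of "k + 1"]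
        by (intro divide_left_mono) (auto simp: power2_eq_square)
      also have "\<dots> = 2 * (1 / \<beta> k - 1 / \<beta> (k + 1))"
        using \<beta>pos[of k] \<beta>pos[of "k + 1"] by (simp add: field_simps)
      finally have "2 * B_p\<^sup>2 * ((\<beta> (k + 1) - \<beta> k) / (\<beta> k)\<^sup>2) \<le> 2 * B_p\<^sup>2 * (2 * (1 / \<beta> k - 1 / \<beta> (k + 1)))"
        by (rule mult_left_mono) simp
      then show ?thesis by (simp add: algebra_simps)
    qed
    ultimately show ?thesis unfolding T_def v_weight diff_divide_distrib mult.assoc by linarith
  qed
  have descent: "\<rho> / 4 * (\<delta> (k + 1))\<^sup>2 \<le> V k - V (k + 1) + 3 * e\<^sup>2 / (256 * \<rho>)" for k
  proof -
    have "P.F_real (x (k + 1 + 1)) + penalty A b g (\<beta> (k + 1)) (y (k + 1)) (z (k + 1)) (x (k + 1 + 1)) + \<rho> / 2 * (\<delta> (k + 1))\<^sup>2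
      \<le> P.F_real (x (k + 1)) + penalty A b g (\<beta> (k + 1)) (y (k + 1)) (z (k + 1)) (x (k + 1))
        + norm (\<xi> (k + 1)) * \<delta> (k + 1) + \<nu> * M_l\<^sup>2 / 2"
      unfolding \<delta>_def by (rule P.descent_step[OF \<xi> \<nu>_pos \<beta>pos xX1])
    moreover have "norm (\<xi> (k + 1)) * \<delta> (k + 1) \<le> \<rho> / 4 * (\<delta> (k + 1))\<^sup>2 + e\<^sup>2 / (256 * \<rho>)"
    proof -
      have "norm (\<xi> (k + 1)) * \<delta> (k + 1) \<le> e / 16 * \<delta> (k + 1)"
        using order_trans[OF \<xi>_eps eps_le(1)] by (intro mult_right_mono) (auto simp: \<delta>_def)
      \<comment> \<open>Young's inequality: half of the proximal gain is spent on the inexactness,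
        at the cost of one unit e^2 / (256 \<rho>); the smoothing costs two more.\<close>
      moreover have "0 \<le> (\<rho> * \<delta> (k + 1) / 2 - e / 16)\<^sup>2 / \<rho>" using rho_pos by simp
      moreover have "(\<rho> * \<delta> (k + 1) / 2 - e / 16)\<^sup>2 / \<rho> = \<rho> / 4 * (\<delta> (k + 1))\<^sup>2 + e\<^sup>2 / (256 * \<rho>) - e / 16 * \<delta> (k + 1)"
        using rho_pos by (simp add: power2_eq_square field_simps)
      ultimately show ?thesis by linarith
    qed
    moreover have "\<nu> * M_l\<^sup>2 / 2 \<le> 2 * e\<^sup>2 / (256 * \<rho>)"
      using \<nu>_small rho_pos by (simp add: field_simps)
    moreover have "V k - V (k + 1) = E k - E (k + 1) + T k - T (k + 1) + 4 * B_p * (v_0 / \<beta>_0) * log_weight k"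
      unfolding V_def by (simp add: distrib_left)
    moreover have "3 * e\<^sup>2 / (256 * \<rho>) = e\<^sup>2 / (256 * \<rho>) + 2 * e\<^sup>2 / (256 * \<rho>)"
      by (simp add: add_divide_distrib[symmetric])
    ultimately show ?thesis using drift[of k] unfolding E_def by linarith
  qed
  define err where "err = 3 * e\<^sup>2 / (256 * \<rho>)"
  \<comment> \<open>E k is evaluated at x (k + 1), so the steps counted from V m begin with index m
    + 1.\<close>
  have total: "(\<Sum>j<n. \<rho> / 4 * (\<delta> (m + j + 1))\<^sup>2) \<le> V m - V (m + n) + real n * err" for m n
  proof (induction n)
    case (Suc n)
    then show ?case using descent[of "m + n", folded err_def] by (simp add: distrib_right)
  qed simp
  have E_bound: "\<bar>E k\<bar> \<le> S + B_p\<^sup>2 / (2 * \<beta>_0)" for k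
  proof -
    have sq: "(norm (q k))\<^sup>2 \<le> B_p\<^sup>2" "(norm (y k, z k))\<^sup>2 \<le> B_p\<^sup>2"
      by (rule power_mono[OF q_bound norm_ge_zero] power_mono[OF p_bound norm_ge_zero])+
    have "penalty A b g (\<beta> k) (y k) (z k) (x (k + 1)) = ((norm (q k))\<^sup>2 - (norm (y k, z k))\<^sup>2) / (2 * \<beta> k)"
      by (rule penalty_eq_multipliers[OF \<beta>pos q_def])
    moreover have "\<bar>((norm (q k))\<^sup>2 - (norm (y k, z k))\<^sup>2) / (2 * \<beta> k)\<bar> \<le> B_p\<^sup>2 / (2 * \<beta>_0)"
    proof -
      \<comment> \<open>Both squares lie between 0 and \<open>B_p\<^sup>2\<close>, so their
        difference costs one such bound, not two.\<close>
      have "\<bar>(norm (q k))\<^sup>2 - (norm (y k, z k))\<^sup>2\<bar> \<le> B_p\<^sup>2"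
        using sq zero_le_power2[of "norm (q k)"] zero_le_power2[of "norm (y k, z k)"] by linarith
      then show ?thesis
        using \<beta>pos[of k] \<beta>_ge0[of k] beta_0_pos by (simp add: abs_divide frac_le)
    qed
    ultimately show ?thesis using F_bound[OF xX1[of k]] unfolding E_def by linarith
  qed
  have T_bound: "0 \<le> T k" "T k \<le> 5 * B_p\<^sup>2 / \<beta>_0" for k
  proof -
    show "0 \<le> T k" using \<beta>pos[of k] by (simp add: T_def)
    have "norm (z k) \<le> B_p" using p_bound[of k] norm_snd_le[of "z k" "y k"] by simp
    then have "(norm (z k))\<^sup>2 + 4 * B_p\<^sup>2 \<le> 5 * B_p\<^sup>2" using power_mono[of "norm (z k)" B_p 2] by simp
    then have "((norm (z k))\<^sup>2 + 4 * B_p\<^sup>2) / \<beta> k \<le> 5 * B_p\<^sup>2 / \<beta>_0"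
      using \<beta>_ge0[of k] beta_0_pos by (intro frac_le) auto
    then show "T k \<le> 5 * B_p\<^sup>2 / \<beta>_0" by (simp add: T_def add_divide_distrib)
  qed
  \<comment> \<open>Two energy bounds give 2 S and one B_p^2 / \<beta>_0, the potential T gives five
    more, and 44 is 4 times the bound 11 on the sum of weights.\<close>
  define R where "R = 2 * S + 6 * B_p\<^sup>2 / \<beta>_0 + 44 * B_p * (v_0 / \<beta>_0)"
  have V_bound: "V m - V (m + n) \<le> R" for m n
  proof -
    have c: "0 \<le> 4 * B_p * (v_0 / \<beta>_0)" using B_p0 v_0_pos beta_0_pos by simp
    have "4 * B_p * (v_0 / \<beta>_0) * (\<Sum>j<m + n. log_weight j) \<le> 4 * B_p * (v_0 / \<beta>_0) * 11"
      using sum_log_weight c by (rule mult_left_mono)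
    moreover have "0 \<le> 4 * B_p * (v_0 / \<beta>_0) * (\<Sum>j<m. log_weight j)"
      by (rule mult_nonneg_nonneg[OF c sum_nonneg[OF log_weight_nonneg]])
    moreover have "2 * (B_p\<^sup>2 / (2 * \<beta>_0)) + 5 * B_p\<^sup>2 / \<beta>_0 = 6 * B_p\<^sup>2 / \<beta>_0"
      by (simp add: add_divide_distrib[symmetric])
    ultimately show ?thesis
      using E_bound[of m] E_bound[of "m + n"] T_bound(2)[of m] T_bound(1)[of "m + n"]
      unfolding V_def R_def by linarith
  qed
  have C_p0: "2 \<le> C_p" "0 \<le> C_p" "4 * B_p \<le> C_p" using C_p B_p0 by auto
  have Bp_Cp: "16 * B_p\<^sup>2 \<le> C_p\<^sup>2"
    using power_mono[OF C_p0(3), of 2] B_p0 by (simp add: power_mult_distrib)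
  have R_less: "R < C_x"
  proof -
    have "6 * B_p\<^sup>2 / \<beta>_0 \<le> 1 / (4 * \<beta>_0) * (14 * C_p\<^sup>2 + 8 * B_p * C_p + 7 * B_p\<^sup>2)"
    proof -
      have "24 * B_p\<^sup>2 \<le> 14 * C_p\<^sup>2 + 8 * B_p * C_p + 7 * B_p\<^sup>2"
        using Bp_Cp B_p0 C_p0 mult_nonneg_nonneg[of B_p C_p] zero_le_power2[of C_p] by linarith
      then have "1 / (4 * \<beta>_0) * (24 * B_p\<^sup>2) \<le> 1 / (4 * \<beta>_0) * (14 * C_p\<^sup>2 + 8 * B_p * C_p + 7 * B_p\<^sup>2)"
        using beta_0_pos by (intro mult_left_mono) auto
      then show ?thesis by simp
    qed
    \<comment> \<open>Strict because C_p is at least 4 B_p + 2; this makes C_x positive and closes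
      the counting argument below.\<close>
    moreover have "44 * B_p * (v_0 / \<beta>_0) < (10 * C_p + 4 * B_p) * (v_0 / \<beta>_0)"
      using C_p v_0_pos beta_0_pos by (intro mult_strict_right_mono) auto
    moreover have "0 \<le> \<beta>_0 / 2 * ((norm (A *v x 0 - b))\<^sup>2 + (norm (pos_part (g (x 0) + (1 / \<beta>_0) *\<^sub>R z 0)))\<^sup>2)"
      using beta_0_pos by simp
    ultimately show ?thesis unfolding C_x_def S_def[symmetric] R_def by linarith
  qed
  have "0 \<le> R"
    using order_trans[OF abs_ge_zero F_bound[OF x_feas]] B_p0 v_0_pos beta_0_pos by (simp add: R_def)
  then have C_x_pos: "0 < C_x" using R_less by simp

  \<comment> \<open>Counting iterations: large penalty first, then a short step\<close>
  define s where "s = sqrt C_5"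
  have sq: "(2 * a / \<beta>_0)\<^sup>2 = 4 * a\<^sup>2 / \<beta>_0\<^sup>2" for a
    by (simp add: power_divide power_mult_distrib)
  \<comment> \<open>C_5 is the larger of two squares, so its root dominates both bases.\<close>
  have s: "2 * C_p / \<beta>_0 \<le> s" "2 * (B_p\<^sup>2 + 5 * C_p\<^sup>2 / 2) / \<beta>_0 \<le> s"
    unfolding s_def by (rule real_le_rsqrt, simp only: sq C_5_def max.cobounded1 max.cobounded2)+
  have s_pos: "0 < s"
    using less_le_trans[OF _ s(1)] C_p0 beta_0_pos by simp
  then have C_5_pos: "0 < C_5" by (simp add: s_def)
  define K where "K = nat \<lceil>C_5 / \<epsilon>\<^sup>2\<rceil>"
  define N where "N = nat \<lceil>64 * \<rho> * C_x * C_4\<^sup>2 / \<epsilon>\<^sup>2\<rceil>"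
  have "0 \<le> C_5 / \<epsilon>\<^sup>2" "0 \<le> 64 * \<rho> * C_x * C_4\<^sup>2 / \<epsilon>\<^sup>2"
    using C_5_pos C_x_pos rho_pos by simp_all
  \<comment> \<open>The form in which a ceiling is recognized as nonnegative, so that
    \<open>nat\<close> loses nothing.\<close>
  then have "- 1 < C_5 / \<epsilon>\<^sup>2" "- 1 < 64 * \<rho> * C_x * C_4\<^sup>2 / \<epsilon>\<^sup>2"
    by linarith+
  then have KN: "int K = \<lceil>C_5 / \<epsilon>\<^sup>2\<rceil>" "int N = \<lceil>64 * \<rho> * C_x * C_4\<^sup>2 / \<epsilon>\<^sup>2\<rceil>"
    by (simp_all add: K_def N_def)
  have K: "C_5 / \<epsilon>\<^sup>2 \<le> real K" by (simp add: K_def real_nat_ceiling_ge)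
  have N: "64 * \<rho> * C_x * C_4\<^sup>2 / \<epsilon>\<^sup>2 \<le> real N" by (simp add: N_def real_nat_ceiling_ge)
  have K1: "1 \<le> K" using C_5_pos eps_pos by (simp add: K_def Suc_le_eq)
  \<comment> \<open>Starting V at K - 1 makes the counted steps exactly those of index K to K + N -
    1; K \<ge> 1 keeps the subtraction from truncating. If all were long, N net gains of e^2 / (64
    \<rho>) would reach C_x, above the total budget R.\<close>
  have "\<exists>j<N. (\<rho> * \<delta> (K - 1 + j + 1))\<^sup>2 \<le> 7 / 64 * e\<^sup>2"
  proof (rule ccontr)
    assume "\<not> (\<exists>j<N. (\<rho> * \<delta> (K - 1 + j + 1))\<^sup>2 \<le> 7 / 64 * e\<^sup>2)"
    then have large: "7 * e\<^sup>2 / (256 * \<rho>) \<le> \<rho> / 4 * (\<delta> (K - 1 + j + 1))\<^sup>2" if "j < N" for j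
    proof -
      have "7 / 64 * e\<^sup>2 \<le> (\<rho> * \<delta> (K - 1 + j + 1))\<^sup>2"
        using \<open>\<not> (\<exists>j<N. _ j)\<close> that by (meson linear)
      then show ?thesis using rho_pos by (simp add: power_mult_distrib field_simps power2_eq_square)
    qed
    have "real N * (7 * e\<^sup>2 / (256 * \<rho>)) = (\<Sum>j<N. 7 * e\<^sup>2 / (256 * \<rho>))" by simp
    also have "\<dots> \<le> (\<Sum>j<N. \<rho> / 4 * (\<delta> (K - 1 + j + 1))\<^sup>2)" by (intro sum_mono large) auto
    also have "\<dots> \<le> R + real N * (3 * e\<^sup>2 / (256 * \<rho>))"
      using total[of "K - 1" N] V_bound[of "K - 1" N] unfolding err_def by linarith
    finally have "real N * (7 * e\<^sup>2 / (256 * \<rho>)) - real N * (3 * e\<^sup>2 / (256 * \<rho>)) < C_x"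
      using R_less by linarith
    moreover have "real N * (7 * e\<^sup>2 / (256 * \<rho>)) - real N * (3 * e\<^sup>2 / (256 * \<rho>)) = real N * (e\<^sup>2 / (64 * \<rho>))"
      by (simp add: field_simps)
    moreover have "C_x = 64 * \<rho> * C_x * C_4\<^sup>2 / \<epsilon>\<^sup>2 * (e\<^sup>2 / (64 * \<rho>))"
      using C_4(1) eps_pos rho_pos by (simp add: e2)
    moreover have "64 * \<rho> * C_x * C_4\<^sup>2 / \<epsilon>\<^sup>2 * (e\<^sup>2 / (64 * \<rho>)) \<le> real N * (e\<^sup>2 / (64 * \<rho>))"
      using N rho_pos by (intro mult_right_mono) auto
    ultimately show False by linarith
  qed
  then obtain j where j: "j < N" and small: "(\<rho> * \<delta> (K - 1 + j + 1))\<^sup>2 \<le> 7 / 64 * e\<^sup>2" by blast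
  define k where "k = K + j"
  have k_eq: "K - 1 + j + 1 = k" using K1 by (simp add: k_def)
  have \<epsilon>\<beta>: "\<beta>_0 * s \<le> \<epsilon> * \<beta> k"
  proof -
    have "C_5 / \<epsilon>\<^sup>2 \<le> real (k + 1)" using K by (simp add: k_def)
    then have "sqrt (C_5 / \<epsilon>\<^sup>2) \<le> sqrt (real (k + 1))" by (rule real_sqrt_le_mono)
    then have "s \<le> \<epsilon> * sqrt (real (k + 1))"
      using eps_pos by (simp add: s_def real_sqrt_divide field_simps)
    then show ?thesis using beta_0_pos by (simp add: beta_def)
  qed
  have s': "2 * C_p \<le> \<beta>_0 * s" "2 * B_p\<^sup>2 + 5 * C_p\<^sup>2 \<le> \<beta>_0 * s"
    using s beta_0_pos by (simp_all add: field_simps)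
  have "near_eps_KKT \<rho> (\<lambda>u. ereal (l (c u)) + h u) A b g \<epsilon> (x k)"
  proof (rule P.near_eps_KKT_of_small_step[OF \<xi>[of k] \<nu>_pos \<beta>pos z_nonneg less_imp_le[OF B_g_pos] B_g_lip
        p_bound q_bound[unfolded q_def] eps_pos e_def C_4(1) C_4(4) C_4(2)])
    show "3 / (2 * \<rho>) * (sqrt (real CARD('m)) * B_g * B_p) \<le> C_4"
    proof -
      \<comment> \<open>The third entry of C_4 has sqrt (\<beta>_0 sqrt C_5) in the place of the
        multiplier bound; C_5 is large enough for this root to dominate B_p.\<close>
      have "B_p\<^sup>2 \<le> \<beta>_0 * s" using s'(2) zero_le_power2[of B_p] zero_le_power2[of C_p] by linarith
      then have "sqrt (real CARD('m) * B_p\<^sup>2) \<le> sqrt (real CARD('m) * (\<beta>_0 * s))"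
        by (intro real_sqrt_le_mono mult_left_mono) auto
      then have "sqrt (real CARD('m)) * B_p \<le> sqrt (real CARD('m) * \<beta>_0 * s)"
        using B_p0 by (simp add: real_sqrt_mult mult.assoc)
      then have "3 / 2 * (B_g / \<rho>) * (sqrt (real CARD('m)) * B_p) \<le> 4 * (B_g / \<rho>) * sqrt (real CARD('m) * \<beta>_0 * s)"
        using B_g_pos rho_pos B_p0 by (intro mult_mono) auto
      also have "\<dots> \<le> C_4" using C_4(3) by (simp add: s_def)
      finally show ?thesis by (simp add: mult.commute mult.left_commute)
    qed
    show "4 * B_p \<le> \<epsilon> * \<beta> k" using \<epsilon>\<beta> s'(1) C_p0 by linarith
    show "4 * B_p\<^sup>2 \<le> \<epsilon> * \<beta> k"
      using \<epsilon>\<beta> s'(2) Bp_Cp zero_le_power2[of B_p] by linarith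
    show "norm (\<xi> k) \<le> e / 16" by (rule order_trans[OF \<xi>_eps eps_le(1)])
    show "\<rho> * (\<nu> * M_l\<^sup>2) \<le> e\<^sup>2 / 64" by (rule \<nu>_small)
    show "(\<rho> * norm (x (k + 1) - x k))\<^sup>2 \<le> 7 / 64 * e\<^sup>2"
      using small unfolding k_eq \<delta>_def .
  qed
  moreover have "int k \<le> \<lceil>C_5 / \<epsilon>\<^sup>2\<rceil> + \<lceil>64 * \<rho> * C_x * C_4\<^sup>2 / \<epsilon>\<^sup>2\<rceil>"
    unfolding KN[symmetric] using j by (simp add: k_def)
  ultimately show ?thesis unfolding F_eq by blast
qed

end
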